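(* Let $2^\omega$ be the Cantor set. For every nonempty finite set $A$ there is a $t \in \mathbb{N}$ such that for every $k \in \mathbb{N}$ and every finite Borel coloring $\gamma : \mathrm{Map}(A, 2^\omega) \to k$ there is an $h \in \mathrm{RSurj}(\omega, \omega)$ such that $$|\gamma(\mathcal{P}(h) \circ \mathrm{Map}(A, 2^\omega))| \le t,$$ where $\mathcal{P}(h) \circ \mathrm{Map}(A, 2^\omega) = \{\mathcal{P}(h) \circ f : f \in \mathrm{Map}(A,2^\omega)\}$. In particular, there is a Cantor set $\mathcal{K} \subseteq 2^\omega$ (a subset homeomorphic to $2^\omega$) such that $|\gamma(\mathrm{Map}(A, \mathcal{K}))| \le t$.
   Context: $\omega = \{0,1,2,\dots\}$ with its usual order, $\mathbb{N} = \{1,2,3,\dots\}$, $k=\{0,\dots,k-1\}$, $2 = \{0,1\}$. $\mathrm{Map}(X,Y) = Y^X$ is the set of all maps $X \to Y$. $2^\omega$ carries the pointwise-convergence (product) topology, and $\mathrm{Map}(A, 2^\omega) = (2^\omega)^A$ carries the product topology. A finite coloring $\gamma : S \to k$ of a topological space is Borel if each $\gamma^{-1}(i)$ is Borel. A rigid surjection $h : \omega \to \omega$ is a surjection with $\min h^{-1}(y_1) < \min h^{-1}(y_2)$ whenever $y_1 < y_2$; $\mathrm{RSurj}(\omega,\omega)$ is the set of these. For a map $h : \omega \to \omega$, $\mathcal{P}(h) : 2^\omega \to 2^\omega$ is given by $\mathcal{P}(h)(x) = x \circ h$ (equivalently, viewing elements of $2^\omega$ as subsets of $\omega$, $X \mapsto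 h^{-1}(X)$). *)

theory Defs
  imports "HOL-Analysis.Analysis"
begin

definition cantor_space :: "(nat \<Rightarrow> bool) topology" where
  "cantor_space = product_topology (\<lambda>_. discrete_topology (UNIV :: bool set)) (UNIV :: nat set)"

text \<open>Maps on a set \<open>A\<close> are represented by extensional functions, i.e. functions taking the value
  \<^const>\<open>undefined\<close> outside \<open>A\<close>; this is the carrier convention of \<^const>\<open>product_topology\<close>.\<close>

definition Map :: "'a set \<Rightarrow> 'b set \<Rightarrow> ('a \<Rightarrow> 'b) set" where
  "Map A Y = (A \<rightarrow>\<^sub>E Y)"

definition Map_space :: "'a set \<Rightarrow> ('a \<Rightarrow> nat \<Rightarrow> bool) topology" where
  "Map_space A = product_topology (\<lambda>_. cantor_space) A"

definition borel_sets_of :: "'a topology \<Rightarrow> 'a set set" where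
  "borel_sets_of X = sigma_sets (topspace X) {U. openin X U}"

definition borel_coloring :: "'a topology \<Rightarrow> nat \<Rightarrow> ('a \<Rightarrow> nat) \<Rightarrow> bool" where
  "borel_coloring X k \<gamma> \<longleftrightarrow>
     \<gamma> \<in> topspace X \<rightarrow> {..<k} \<and> (\<forall>i<k. {x \<in> topspace X. \<gamma> x = i} \<in> borel_sets_of X)"

definition RSurj :: "(nat \<Rightarrow> nat) set" where
  "RSurj = {h. surj h \<and>
     (\<forall>y1 y2. y1 < y2 \<longrightarrow> (LEAST x. x \<in> h -` {y1}) < (LEAST x. x \<in> h -` {y2}))}"

definition Pfun :: "(nat \<Rightarrow> nat) \<Rightarrow> (nat \<Rightarrow> bool) \<Rightarrow> (nat \<Rightarrow> bool)" where
  "Pfun h x = x \<circ> h"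

definition is_cantor_set :: "(nat \<Rightarrow> bool) set \<Rightarrow> bool" where
  "is_cantor_set K \<longleftrightarrow> subtopology cantor_space K homeomorphic_space cantor_space"

lemma topspace_cantor_space: "topspace cantor_space = UNIV"
  by (simp add: cantor_space_def)

lemma topspace_Map_space: "topspace (Map_space A) = Map A UNIV"
  by (simp add: Map_space_def Map_def topspace_cantor_space)

end

theory Submission
  imports Defs
begin

text \<open>
  A map \<open>A \<rightarrow> 2\<^sup>\<omega>\<close> is a word \<open>\<omega> \<rightarrow> 2\<^sup>A\<close>, hence a rigid surjection \<open>\<omega> \<rightarrow> m\<close> followed by one of finitely many
  maps \<open>m \<rightarrow> 2\<^sup>A\<close>, and composition with \<open>\<P>(h)\<close> acts on the rigid surjection. So it suffices to make
  finitely many Borel colourings of rigid surjections \<open>\<omega> \<rightarrow> m\<close> constant on all \<open>w \<circ> h\<close>, which is the dual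
  Ramsey theorem of Carlson and Simpson.

  For that theorem the colour of \<open>w\<close> is made to depend on ever shorter prefixes of \<open>w\<close>: first on the part up
  to the first occurrence of the last letter (a Borel colouring is constant on a comeagre subset of a
  cylinder), then on the part up to the first occurrence of the letter \<open>j\<close>, for \<open>j = m - 2, \<dots>, 0\<close> (by
  the Carlson--Simpson lemma on colourings of finite words). Each step treats one prefix at a time
  and is completed by a fusion argument. The Carlson--Simpson lemma comes from minimal idempotents
  in the semigroup of ultrafilters on finite words.
\<close>

section \<open>Ultrafilters on words\<close>

text \<open>Read a map as a 0-1 matrix with rows in \<open>A\<close>. Composition with
  \<open>Pfun h\<close> repeats and rearranges its columns but, \<open>h\<close> being a rigid
  surjection, keeps the set of columns and the order of their first appearances. A colouring by this
  finite datum survives every \<open>h\<close>, so one colour is too much to ask; \<open>t\<close>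
  counts pairs of a number of letters and an assignment of columns to letters, and thus depends on
  \<open>A\<close> alone. The obstacle is that a Borel colouring sees the whole infinite word, while
  ultrafilters on words control finite words only. Category serves just to discard the tail after
  the last new letter has appeared; all later steps are about finite words. There a word is cut
  right before the first occurrence of a letter, and the cut must never split a block of the
  construction. Hence the blocks have to begin with their variable, which is why \<open>q\<close> is
  required to contain \<open>range (Cons k)\<close>. Fusion works because a new factor
  \<open>g\<close> is inserted between the word and the earlier factors, as in
  \<open>w \<circ> (g \<circ> h)\<close>: if \<open>g\<close> fixes an initial segment, prefixes of
  \<open>w\<close> treated earlier stay treated.\<close>

definition ultra :: "'a set set \<Rightarrow> bool" where
  "ultra U \<longleftrightarrow> {} \<notin> U \<and> (\<forall>A\<in>U. \<forall>B\<in>U. A \<inter> B \<in> U) \<and>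
     (\<forall>A B. A \<in> U \<longrightarrow> A \<subseteq> B \<longrightarrow> B \<in> U) \<and> (\<forall>A. A \<in> U \<or> - A \<in> U)"

definition fip :: "'a set set \<Rightarrow> bool" where
  "fip F \<longleftrightarrow> (\<forall>S. finite S \<longrightarrow> S \<subseteq> F \<longrightarrow> \<Inter>S \<noteq> {})"

lemma ultra_empty: "ultra U \<Longrightarrow> {} \<notin> U"
  and ultra_Int: "ultra U \<Longrightarrow> A \<in> U \<Longrightarrow> B \<in> U \<Longrightarrow> A \<inter> B \<in> U"
  and ultra_mono: "ultra U \<Longrightarrow> A \<in> U \<Longrightarrow> A \<subseteq> B \<Longrightarrow> B \<in> U"
  and ultra_dichotomy: "ultra U \<Longrightarrow> A \<in> U \<or> - A \<in> U"
  unfolding ultra_def by blast+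

lemma ultra_UNIV: "ultra U \<Longrightarrow> UNIV \<in> U"
  using ultra_dichotomy ultra_mono by blast

lemma ultra_Compl_iff: "ultra U \<Longrightarrow> - A \<in> U \<longleftrightarrow> A \<notin> U"
  using ultra_dichotomy[of U A] ultra_Int[of U A "- A"] ultra_empty[of U] by auto

lemma ultra_finite_INT:
  assumes "ultra U" "finite I" "\<And>i. i \<in> I \<Longrightarrow> {x. P i x} \<in> U"
  shows "{x. \<forall>i\<in>I. P i x} \<in> U"
  using assms(2,3)
proof (induction I rule: finite_induct)
  case empty
  then show ?case by (simp add: ultra_UNIV assms(1))
next
  case (insert i I)
  then have "{x. P i x} \<inter> {x. \<forall>i\<in>I. P i x} \<in> U"
    by (intro ultra_Int[OF assms(1)]) auto
  then show ?case by (simp add: Collect_conj_eq)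
qed

lemma ultra_eqI:
  assumes "ultra p" "ultra q" "p \<subseteq> q"
  shows "p = q"
proof
  show "q \<subseteq> p"
  proof
    fix A assume "A \<in> q"
    then have "- A \<notin> q" using ultra_Compl_iff assms(2) by blast
    then show "A \<in> p" using ultra_dichotomy assms(1,3) by blast
  qed
qed (rule assms(3))

text \<open>A maximal family with the finite intersection property is an ultrafilter: a set that
  meets all its finite intersections could be added, so it is a member already.\<close>

lemma ultra_extension:
  assumes "fip F"
  shows "\<exists>U. ultra U \<and> F \<subseteq> U"
proof -
  let ?\<A> = "{G. F \<subseteq> G \<and> fip G}"
  have "\<exists>M\<in>?\<A>. \<forall>X\<in>?\<A>. M \<subseteq> X \<longrightarrow> X = M"
  proof (rule subset_Zorn_nonempty)
    show "?\<A> \<noteq> {}" using assms by blast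
  next
    fix \<C> assume ne: "\<C> \<noteq> {}" and ch: "subset.chain ?\<A> \<C>"
    have "fip (\<Union>\<C>)"
      unfolding fip_def
    proof (intro allI impI)
      fix S assume "finite S" "S \<subseteq> \<Union>\<C>"
      then obtain G where "G \<in> \<C>" "S \<subseteq> G"
        using finite_subset_Union_chain ne ch by metis
      moreover have "fip G" using \<open>G \<in> \<C>\<close> ch by (auto simp: subset.chain_def)
      ultimately show "\<Inter>S \<noteq> {}" using \<open>finite S\<close> unfolding fip_def by blast
    qed
    moreover have "\<C> \<subseteq> ?\<A>" using ch by (simp add: subset.chain_def)
    ultimately show "\<Union>\<C> \<in> ?\<A>" using ne by blast
  qed
  then obtain M where "M \<in> ?\<A>" and maxA: "\<forall>X\<in>?\<A>. M \<subseteq> X \<longrightarrow> X = M" ..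
  then have FM: "F \<subseteq> M" and fM: "fip M" by simp_all
  have max: "X = M" if "M \<subseteq> X" "fip X" for X
    using maxA that FM by (metis (mono_tags, lifting) mem_Collect_eq order_trans)
  have mem: "A \<in> M" if A: "\<And>S. finite S \<Longrightarrow> S \<subseteq> M \<Longrightarrow> A \<inter> \<Inter>S \<noteq> {}" for A
  proof -
    have "fip (insert A M)"
      unfolding fip_def
    proof (intro allI impI)
      fix S assume "finite S" "S \<subseteq> insert A M"
      then have "A \<inter> \<Inter>(S - {A}) \<noteq> {}" by (intro A) auto
      then show "\<Inter>S \<noteq> {}" by blast
    qed
    then show ?thesis using max by blast
  qed
  have sub: "A \<in> M" if "finite S" "S \<subseteq> M" "\<Inter>S \<subseteq> A" for A S
  proof (rule mem)
    fix S' assume "finite S'" "S' \<subseteq> M"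
    then have "\<Inter>(S \<union> S') \<noteq> {}" using fM that unfolding fip_def by (metis Un_least finite_UnI)
    then show "A \<inter> \<Inter>S' \<noteq> {}" using that(3) by blast
  qed
  have "ultra M"
    unfolding ultra_def
  proof (intro conjI ballI allI impI)
    show "{} \<notin> M" using fM unfolding fip_def by (metis Inter_insert Int_empty_left empty_subsetI
          finite.emptyI finite.insertI insert_subset)
  next
    fix A B assume "A \<in> M" "B \<in> M"
    then show "A \<inter> B \<in> M" by (intro sub[of "{A, B}"]) auto
  next
    fix A B assume "A \<in> M" "A \<subseteq> B"
    then show "B \<in> M" by (intro sub[of "{A}"]) auto
  next
    fix A show "A \<in> M \<or> - A \<in> M"
    proof (rule ccontr)
      assume "\<not> (A \<in> M \<or> - A \<in> M)"
      then obtain S S' where "finite S" "S \<subseteq> M" "A \<inter> \<Inter>S = {}" "finite S'" "S' \<subseteq> M" "- A \<inter> \<Inter>S' = {}"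
        using mem by metis
      then have "finite (S \<union> S')" "S \<union> S' \<subseteq> M" "\<Inter>(S \<union> S') = {}" by blast+
      then show False using fM unfolding fip_def by blast
    qed
  qed
  then show ?thesis using FM by blast
qed

lemma ultra_extension_filter:
  assumes "F \<noteq> {}" "{} \<notin> F" "\<And>A B. A \<in> F \<Longrightarrow> B \<in> F \<Longrightarrow> A \<inter> B \<in> F"
  shows "\<exists>U. ultra U \<and> F \<subseteq> U"
proof (rule ultra_extension)
  have "S = {} \<or> \<Inter>S \<in> F" if "finite S" "S \<subseteq> F" for S
    using that by (induction S rule: finite_induct) (auto intro: assms(3))
  then show "fip F"
    unfolding fip_def using assms(2) by (metis Inter_empty UNIV_not_empty)
qed

text \<open>Closedness in the Stone topology: \<open>T\<close> contains every ultrafilter all of whose members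
  belong to some element of \<open>T\<close>.\<close>

definition uclosed :: "'a set set set \<Rightarrow> bool" where
  "uclosed T \<longleftrightarrow> (\<forall>p\<in>T. ultra p) \<and> (\<forall>p. ultra p \<longrightarrow> (\<forall>A\<in>p. \<exists>q\<in>T. A \<in> q) \<longrightarrow> p \<in> T)"

lemma uclosed_ultra: "uclosed T \<Longrightarrow> p \<in> T \<Longrightarrow> ultra p"
  unfolding uclosed_def by blast

text \<open>A set \<open>A \<in> p\<close> that belongs to no member of \<open>T\<close> would put
  \<open>- A\<close> into all of them, hence into \<open>p\<close>. So a closed set is recovered
  from the filter \<open>\<Inter>T\<close>.\<close>

lemma uclosed_Inter_mem:
  assumes "uclosed T" "ultra p" "\<Inter>T \<subseteq> p"
  shows "p \<in> T"
proof -
  have "\<exists>q\<in>T. A \<in> q" if "A \<in> p" for A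
  proof (rule ccontr)
    assume "\<not> ?thesis"
    then have "- A \<in> \<Inter>T" using uclosed_ultra[OF assms(1)] ultra_dichotomy by blast
    then show False using assms that ultra_Compl_iff by blast
  qed
  then show ?thesis using assms unfolding uclosed_def by blast
qed

lemma uclosed_INT:
  assumes "\<C> \<noteq> {}" "\<And>T. T \<in> \<C> \<Longrightarrow> uclosed T"
  shows "uclosed (\<Inter>\<C>)"
proof -
  have "p \<in> \<Inter>\<C>" if "ultra p" "\<forall>A\<in>p. \<exists>q\<in>\<Inter>\<C>. A \<in> q" for p
    using assms(2) that unfolding uclosed_def by (meson InterE InterI)
  moreover have "ultra p" if "p \<in> \<Inter>\<C>" for p
    using assms that uclosed_ultra by (metis InterE ex_in_conv)
  ultimately show ?thesis unfolding uclosed_def by blast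
qed

text \<open>Compactness of the Stone space: along a chain the filters \<open>\<Inter>T\<close> are
  nested, so their union is a proper filter, and an ultrafilter extending it lies in every
  \<open>T\<close>.\<close>

lemma uclosed_chain_Inter_nonempty:
  assumes ne: "\<C> \<noteq> {}" and cl: "\<And>T. T \<in> \<C> \<Longrightarrow> uclosed T \<and> T \<noteq> {}"
    and ch: "\<And>S T. S \<in> \<C> \<Longrightarrow> T \<in> \<C> \<Longrightarrow> S \<subseteq> T \<or> T \<subseteq> S"
  shows "\<Inter>\<C> \<noteq> {}"
proof -
  have u: "ultra p" if "p \<in> T" "T \<in> \<C>" for p T using that cl uclosed_ultra by blast
  have "\<exists>U. ultra U \<and> (\<Union>T\<in>\<C>. \<Inter>T) \<subseteq> U"
  proof (rule ultra_extension_filter)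
    show "(\<Union>T\<in>\<C>. \<Inter>T) \<noteq> {}" using ne u ultra_UNIV by blast
    show "{} \<notin> (\<Union>T\<in>\<C>. \<Inter>T)"
    proof
      assume "{} \<in> (\<Union>T\<in>\<C>. \<Inter>T)"
      then obtain T where T: "T \<in> \<C>" "{} \<in> \<Inter>T" by (rule UN_E)
      then obtain p where "p \<in> T" using cl by blast
      then show False using T u[of p T] ultra_empty[of p] by (meson InterD)
    qed
  next
    fix A B assume "A \<in> (\<Union>T\<in>\<C>. \<Inter>T)" "B \<in> (\<Union>T\<in>\<C>. \<Inter>T)"
    then obtain S T where "S \<in> \<C>" "T \<in> \<C>" "A \<in> \<Inter>S" "B \<in> \<Inter>T" by blast
    then obtain R where "R \<in> \<C>" "A \<in> \<Inter>R" "B \<in> \<Inter>R"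
      using ch[of S T] by (metis Inter_anti_mono subsetD)
    then have "A \<inter> B \<in> \<Inter>R" using u ultra_Int by blast
    then show "A \<inter> B \<in> (\<Union>T\<in>\<C>. \<Inter>T)" using \<open>R \<in> \<C>\<close> by blast
  qed
  then obtain U where "ultra U" "(\<Union>T\<in>\<C>. \<Inter>T) \<subseteq> U" by blast
  then have "U \<in> T" if "T \<in> \<C>" for T
    using that cl by (intro uclosed_Inter_mem) auto
  then show ?thesis by blast
qed

text \<open>Zorn's lemma downwards, with compactness bounding the chains. It serves both for closed
  subsemigroups and for closed left ideals.\<close>

lemma uclosed_minimal:
  assumes ne: "\<T> \<noteq> {}" and cl: "\<And>T. T \<in> \<T> \<Longrightarrow> uclosed T \<and> T \<noteq> {}"
    and int: "\<And>\<C>. \<C> \<noteq> {} \<Longrightarrow> \<C> \<subseteq> \<T> \<Longrightarrow> \<Inter>\<C> \<noteq> {} \<Longrightarrow> \<Inter>\<C> \<in> \<T>"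
  shows "\<exists>M\<in>\<T>. \<forall>T\<in>\<T>. T \<subseteq> M \<longrightarrow> T = M"
proof -
  have "\<exists>M\<in>\<T>. \<forall>T\<in>\<T>. M \<supseteq> T \<longrightarrow> T = M"
  proof (rule predicate_Zorn)
    show "partial_order_on \<T> (relation_of (\<lambda>S T. T \<subseteq> S) \<T>)"
      by (rule partial_order_on_relation_ofI) auto
  next
    fix \<C> assume C: "\<C> \<in> Chains (relation_of (\<lambda>S T. T \<subseteq> S) \<T>)"
    then have sub: "\<C> \<subseteq> \<T>" and ch: "\<And>S T. S \<in> \<C> \<Longrightarrow> T \<in> \<C> \<Longrightarrow> S \<subseteq> T \<or> T \<subseteq> S"
      by (auto simp: Chains_def relation_of_def)
    show "\<exists>u\<in>\<T>. \<forall>a\<in>\<C>. u \<subseteq> a"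
    proof (cases "\<C> = {}")
      case True
      then show ?thesis using ne by blast
    next
      case False
      have "\<Inter>\<C> \<noteq> {}"
        using sub cl ch by (intro uclosed_chain_Inter_nonempty[OF False]) auto
      then show ?thesis using int[OF False sub] by blast
    qed
  qed
  then show ?thesis by blast
qed

section \<open>The semigroup of ultrafilters under concatenation (Stone-Cech compactification of the
  words)\<close>

definition umul :: "'a list set set \<Rightarrow> 'a list set set \<Rightarrow> 'a list set set" (infixl \<open>\<odot>\<close> 70) where
  "p \<odot> q = {A. {x. {y. x @ y \<in> A} \<in> q} \<in> p}"

definition umap :: "('a \<Rightarrow> 'b) \<Rightarrow> 'a set set \<Rightarrow> 'b set set" where
  "umap f p = {A. f -` A \<in> p}"

lemma umul_assoc: "p \<odot> q \<odot> r = p \<odot> (q \<odot> r)"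
  by (simp add: umul_def)

lemma ultra_umul:
  assumes "ultra p" "ultra q"
  shows "ultra (p \<odot> q)"
  unfolding ultra_def umul_def mem_Collect_eq
proof (intro conjI ballI allI impI)
  show "{x. {y. x @ y \<in> {}} \<in> q} \<notin> p"
    using ultra_empty assms by (simp add: ultra_empty)
next
  fix A B assume "A \<in> {A. {x. {y. x @ y \<in> A} \<in> q} \<in> p}" "B \<in> {A. {x. {y. x @ y \<in> A} \<in> q} \<in> p}"
  then have "{x. {y. x @ y \<in> A} \<in> q} \<inter> {x. {y. x @ y \<in> B} \<in> q} \<in> p"
    using ultra_Int assms by auto
  then show "{x. {y. x @ y \<in> A \<inter> B} \<in> q} \<in> p"
    by (rule ultra_mono[OF assms(1)]) (use ultra_Int[OF assms(2)] in \<open>auto simp: Collect_conj_eq\<close>)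
next
  fix A B :: "'a list set" assume "{x. {y. x @ y \<in> A} \<in> q} \<in> p" "A \<subseteq> B"
  then show "{x. {y. x @ y \<in> B} \<in> q} \<in> p"
    by (elim ultra_mono[OF assms(1)]) (auto elim!: ultra_mono[OF assms(2)])
next
  fix A :: "'a list set"
  have "{x. {y. x @ y \<in> - A} \<in> q} = - {x. {y. x @ y \<in> A} \<in> q}"
    using ultra_Compl_iff[OF assms(2)] by (auto simp: Collect_neg_eq)
  then show "{x. {y. x @ y \<in> A} \<in> q} \<in> p \<or> {x. {y. x @ y \<in> - A} \<in> q} \<in> p"
    using ultra_dichotomy[OF assms(1)] by simp
qed

lemma ultra_umap:
  assumes "ultra p"
  shows "ultra (umap f p)"
  using assms unfolding ultra_def umap_def mem_Collect_eq vimage_empty vimage_Int vimage_Compl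
  by (metis (no_types, lifting) mem_Collect_eq vimage_mono)

lemma ultra_principal: "ultra {A. w \<in> A}"
  unfolding ultra_def by auto

lemma umap_umul:
  assumes "\<And>x y. f (x @ y) = f x @ f y"
  shows "umap f (p \<odot> q) = umap f p \<odot> umap f q"
  by (simp add: umap_def umul_def vimage_def assms)

text \<open>Multiplication by \<open>x\<close> on the right is continuous:
  \<open>A \<in> y \<odot> x\<close> says that one set, which depends only on \<open>A\<close> and
  \<open>x\<close>, belongs to \<open>y\<close>. So the equation is a closed condition on
  \<open>y\<close>.\<close>

lemma uclosed_stabilizer:
  assumes "uclosed T" "ultra x"
  shows "uclosed {y \<in> T. y \<odot> x = x}"
  unfolding uclosed_def
proof (intro conjI ballI allI impI)
  fix p assume p: "ultra p" and near: "\<forall>A\<in>p. \<exists>q\<in>{y \<in> T. y \<odot> x = x}. A \<in> q"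
  have "\<forall>A\<in>p. \<exists>q\<in>T. A \<in> q"
  proof
    fix A assume "A \<in> p"
    then show "\<exists>q\<in>T. A \<in> q" using near by (elim ballE bexE) auto
  qed
  then have "p \<in> T" using assms(1) p unfolding uclosed_def by simp
  moreover have "x \<subseteq> p \<odot> x"
  proof
    fix A assume A: "A \<in> x"
    show "A \<in> p \<odot> x"
    proof (rule ccontr)
      assume "A \<notin> p \<odot> x"
      then have "- {s. {y. s @ y \<in> A} \<in> x} \<in> p"
        using ultra_Compl_iff[OF p] by (simp add: umul_def)
      then obtain q where q: "q \<in> T" "q \<odot> x = x" "- {s. {y. s @ y \<in> A} \<in> x} \<in> q"
        using near by blast
      then have "A \<notin> q \<odot> x"
        using ultra_Compl_iff[OF uclosed_ultra[OF assms(1) q(1)]] unfolding umul_def by blast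
      then show False using q A by simp
    qed
  qed
  ultimately show "p \<in> {y \<in> T. y \<odot> x = x}"
    using ultra_eqI[OF assms(2) ultra_umul[OF p assms(2)]] by simp
next
  fix p assume "p \<in> {y \<in> T. y \<odot> x = x}"
  then show "ultra p" using uclosed_ultra[OF assms(1)] by simp
qed

text \<open>A continuous image of a compact set. For \<open>p\<close> in the closure, a preimage has
  to contain the sets \<open>?D A\<close> with \<open>A \<in> p\<close>, which make the product
  equal to \<open>p\<close>, and the members of \<open>\<Inter>T\<close>, which place it in
  \<open>T\<close>; together these generate a proper filter.\<close>

lemma uclosed_umul_image:
  assumes "uclosed T" "ultra x"
  shows "uclosed ((\<lambda>y. y \<odot> x) ` T)"
  unfolding uclosed_def
proof (intro conjI ballI allI impI)
  fix p assume p: "ultra p" and near: "\<forall>A\<in>p. \<exists>q\<in>(\<lambda>y. y \<odot> x) ` T. A \<in> q"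
  let ?D = "\<lambda>A. {s. {y. s @ y \<in> A} \<in> x}"
  have D: "?D A \<inter> ?D A' = ?D (A \<inter> A')" for A A'
    using ultra_Int[OF assms(2)] ultra_mono[OF assms(2)]
    by (auto simp: Collect_conj_eq)
  have "\<exists>U. ultra U \<and> {?D A \<inter> B |A B. A \<in> p \<and> B \<in> \<Inter>T} \<subseteq> U"
  proof (rule ultra_extension_filter)
    show "{?D A \<inter> B |A B. A \<in> p \<and> B \<in> \<Inter>T} \<noteq> {}"
      using ultra_UNIV[OF p] ultra_UNIV uclosed_ultra[OF assms(1)] by blast
    show "{} \<notin> {?D A \<inter> B |A B. A \<in> p \<and> B \<in> \<Inter>T}"
    proof
      assume "{} \<in> {?D A \<inter> B |A B. A \<in> p \<and> B \<in> \<Inter>T}"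
      then obtain A B where A: "A \<in> p" and B: "B \<in> \<Inter>T" and e: "?D A \<inter> B = {}" by auto
      obtain y where "y \<in> T" "A \<in> y \<odot> x" using near A by blast
      then have "?D A \<inter> B \<in> y"
        using B by (intro ultra_Int[OF uclosed_ultra[OF assms(1)]]) (auto simp: umul_def)
      then show False using e ultra_empty[OF uclosed_ultra[OF assms(1) \<open>y \<in> T\<close>]] by simp
    qed
  next
    fix X Y assume "X \<in> {?D A \<inter> B |A B. A \<in> p \<and> B \<in> \<Inter>T}" "Y \<in> {?D A \<inter> B |A B. A \<in> p \<and> B \<in> \<Inter>T}"
    then obtain A B A' B' where "A \<in> p" "B \<in> \<Inter>T" "A' \<in> p" "B' \<in> \<Inter>T" "X = ?D A \<inter> B" "Y = ?D A' \<inter> B'"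
      by auto
    moreover have "X \<inter> Y = ?D (A \<inter> A') \<inter> (B \<inter> B')" using calculation D[of A A'] by blast
    moreover have "A \<inter> A' \<in> p" using calculation ultra_Int[OF p] by blast
    moreover have "B \<inter> B' \<in> \<Inter>T" using calculation ultra_Int uclosed_ultra[OF assms(1)] by blast
    ultimately show "X \<inter> Y \<in> {?D A \<inter> B |A B. A \<in> p \<and> B \<in> \<Inter>T}" by blast
  qed
  then obtain U where U: "ultra U" and U': "{?D A \<inter> B |A B. A \<in> p \<and> B \<in> \<Inter>T} \<subseteq> U"
    by (elim exE conjE)
  have sub: "?D A \<inter> B \<in> U" if "A \<in> p" "B \<in> \<Inter>T" for A B
    by (rule subsetD[OF U']) (use that in \<open>unfold mem_Collect_eq, iprover\<close>)
  have "\<Inter>T \<subseteq> U" using sub[OF ultra_UNIV[OF p]] ultra_mono[OF U] by blast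
  then have "U \<in> T" using uclosed_Inter_mem assms(1) U by blast
  moreover have "p \<subseteq> U \<odot> x"
  proof
    fix A assume "A \<in> p"
    moreover have "UNIV \<in> \<Inter>T" using ultra_UNIV uclosed_ultra[OF assms(1)] by blast
    ultimately have "?D A \<inter> UNIV \<in> U" using sub by blast
    then show "A \<in> U \<odot> x" by (simp add: umul_def)
  qed
  ultimately show "p \<in> (\<lambda>y. y \<odot> x) ` T"
    using ultra_eqI[OF p ultra_umul[OF U assms(2)]] by blast
next
  fix p assume "p \<in> (\<lambda>y. y \<odot> x) ` T"
  then show "ultra p" using uclosed_ultra[OF assms(1)] ultra_umul assms(2) by auto
qed

text \<open>The Ellis-Numakura lemma. For \<open>x\<close> in a minimal closed subsemigroup
  \<open>M\<close>, the set of all \<open>y \<odot> x\<close> is again one, so it is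
  \<open>M\<close> and some \<open>y \<in> M\<close> satisfies \<open>y \<odot> x = x\<close>. Such
  \<open>y\<close> form a closed subsemigroup, hence all of \<open>M\<close>, and \<open>x\<close>
  itself is among them.\<close>

lemma uclosed_idempotent:
  assumes "uclosed T" "T \<noteq> {}" "\<And>x y. x \<in> T \<Longrightarrow> y \<in> T \<Longrightarrow> x \<odot> y \<in> T"
  shows "\<exists>e\<in>T. e \<odot> e = e"
proof -
  let ?\<T> = "{S. S \<subseteq> T \<and> uclosed S \<and> S \<noteq> {} \<and> (\<forall>x\<in>S. \<forall>y\<in>S. x \<odot> y \<in> S)}"
  have "\<exists>M\<in>?\<T>. \<forall>S\<in>?\<T>. S \<subseteq> M \<longrightarrow> S = M"
  proof (rule uclosed_minimal)
    show "?\<T> \<noteq> {}" using assms by blast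
  next
    fix \<C> assume "\<C> \<noteq> {}" "\<C> \<subseteq> ?\<T>" "\<Inter>\<C> \<noteq> {}"
    moreover have "uclosed (\<Inter>\<C>)" using calculation by (intro uclosed_INT) auto
    moreover have "\<Inter>\<C> \<subseteq> T" using calculation(1,2) by (intro Inter_subset) auto
    moreover have "x \<odot> y \<in> \<Inter>\<C>" if "x \<in> \<Inter>\<C>" "y \<in> \<Inter>\<C>" for x y
      using calculation(2) that by (auto simp: subset_iff)
    ultimately show "\<Inter>\<C> \<in> ?\<T>" by simp
  qed blast
  then obtain M where MT: "M \<in> ?\<T>" and minT: "\<forall>S\<in>?\<T>. S \<subseteq> M \<longrightarrow> S = M" ..
  have M: "M \<subseteq> T" "uclosed M" "M \<noteq> {}" "\<And>x y. x \<in> M \<Longrightarrow> y \<in> M \<Longrightarrow> x \<odot> y \<in> M"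
    using MT by simp_all
  have min: "S = M" if "S \<subseteq> M" "uclosed S" "S \<noteq> {}" "\<And>x y. x \<in> S \<Longrightarrow> y \<in> S \<Longrightarrow> x \<odot> y \<in> S" for S
    using minT[rule_format, of S] that M(1) by simp
  obtain x where x: "x \<in> M" using M(3) by blast
  have ux: "ultra x" using uclosed_ultra M(2) x by blast
  have "(\<lambda>y. y \<odot> x) ` M = M"
  proof (rule min)
    show "uclosed ((\<lambda>y. y \<odot> x) ` M)" by (rule uclosed_umul_image[OF M(2) ux])
  next
    fix a b assume "a \<in> (\<lambda>y. y \<odot> x) ` M" "b \<in> (\<lambda>y. y \<odot> x) ` M"
    then obtain y z where "y \<in> M" "z \<in> M" "a = y \<odot> x" "b = z \<odot> x" by blast
    then have "a \<odot> b = (y \<odot> x \<odot> z) \<odot> x" "y \<odot> x \<odot> z \<in> M" using M(4) x by (auto simp: umul_assoc)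
    then show "a \<odot> b \<in> (\<lambda>y. y \<odot> x) ` M" by blast
  qed (use M x in auto)
  then have "x \<in> (\<lambda>y. y \<odot> x) ` M" using x by simp
  then obtain y where "x = y \<odot> x" "y \<in> M" by (rule imageE)
  then have "y \<in> {y \<in> M. y \<odot> x = x}" by simp
  then have ex: "{y \<in> M. y \<odot> x = x} \<noteq> {}" by (metis (lifting) empty_iff)
  have "{y \<in> M. y \<odot> x = x} = M"
  proof (rule min[OF _ uclosed_stabilizer[OF M(2) ux] ex])
    fix a b assume "a \<in> {y \<in> M. y \<odot> x = x}" "b \<in> {y \<in> M. y \<odot> x = x}"
    then show "a \<odot> b \<in> {y \<in> M. y \<odot> x = x}" using M(4) by (simp add: umul_assoc)
  qed simp
  then have "x \<odot> x = x" using x by blast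
  then show ?thesis using x M(1) by blast
qed

definition left_ideal :: "'a list set set set \<Rightarrow> 'a list set set set \<Rightarrow> bool" where
  "left_ideal T L \<longleftrightarrow> L \<subseteq> T \<and> L \<noteq> {} \<and> uclosed L \<and> (\<forall>x\<in>T. \<forall>y\<in>L. x \<odot> y \<in> L)"

text \<open>For \<open>l\<close> in a minimal \<open>L\<close>, the products
  \<open>y \<odot> l\<close> with \<open>y \<in> T\<close> form a left ideal inside
  \<open>L\<close>, hence all of \<open>L\<close>. Being a closed subsemigroup, \<open>L\<close>
  contains an idempotent.\<close>

lemma minimal_left_ideal_exists:
  assumes T: "uclosed T" "T \<noteq> {}" "\<And>x y. x \<in> T \<Longrightarrow> y \<in> T \<Longrightarrow> x \<odot> y \<in> T"
  shows "\<exists>L. left_ideal T L \<and> (\<exists>e\<in>L. e \<odot> e = e) \<and> (\<forall>l\<in>L. (\<lambda>y. y \<odot> l) ` T = L)"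
proof -
  have "\<exists>M\<in>Collect (left_ideal T). \<forall>S\<in>Collect (left_ideal T). S \<subseteq> M \<longrightarrow> S = M"
  proof (rule uclosed_minimal)
    show "Collect (left_ideal T) \<noteq> {}" using assms unfolding left_ideal_def by blast
  next
    fix \<C> assume *: "\<C> \<noteq> {}" "\<C> \<subseteq> Collect (left_ideal T)" "\<Inter>\<C> \<noteq> {}"
    have "uclosed (\<Inter>\<C>)" using * by (intro uclosed_INT) (auto simp: left_ideal_def)
    moreover have "\<Inter>\<C> \<subseteq> T"
      using *(1,2) by (intro Inter_subset) (force simp: left_ideal_def)+
    moreover have "x \<odot> y \<in> \<Inter>\<C>" if "x \<in> T" "y \<in> \<Inter>\<C>" for x y
      using * that by (auto simp: left_ideal_def)
    ultimately show "\<Inter>\<C> \<in> Collect (left_ideal T)" using * unfolding left_ideal_def by blast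
  qed (auto simp: left_ideal_def)
  then obtain L where L: "left_ideal T L" and min: "\<And>S. left_ideal T S \<Longrightarrow> S \<subseteq> L \<Longrightarrow> S = L"
    by (metis (full_types) mem_Collect_eq)
  have "\<exists>e\<in>L. e \<odot> e = e"
    using L by (intro uclosed_idempotent) (auto simp: left_ideal_def)
  moreover have "(\<lambda>y. y \<odot> l) ` T = L" if l: "l \<in> L" for l
  proof (rule min)
    show "(\<lambda>y. y \<odot> l) ` T \<subseteq> L" using L l by (auto simp: left_ideal_def)
    have "ultra l" using L l uclosed_ultra by (auto simp: left_ideal_def)
    then have "uclosed ((\<lambda>y. y \<odot> l) ` T)" by (rule uclosed_umul_image[OF T(1)])
    moreover have "x \<odot> z \<in> (\<lambda>y. y \<odot> l) ` T" if "x \<in> T" "z \<in> (\<lambda>y. y \<odot> l) ` T" for x z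
      using that T(3) by (auto simp: umul_assoc[symmetric])
    moreover have "l \<in> T" using L l by (auto simp: left_ideal_def)
    ultimately show "left_ideal T ((\<lambda>y. y \<odot> l) ` T)"
      using T unfolding left_ideal_def by blast
  qed
  ultimately show ?thesis using L by (intro exI[of _ L]) simp
qed

text \<open>Letters below \<open>k\<close> are constants; every other letter is read as the variable, which
  \<open>subst k a\<close> replaces by \<open>a\<close>.\<close>

definition subst :: "nat \<Rightarrow> nat \<Rightarrow> nat list \<Rightarrow> nat list" where
  "subst k a = map (\<lambda>i. if i < k then i else a)"

lemma subst_append: "subst k a (x @ y) = subst k a x @ subst k a y"
  by (simp add: subst_def)

lemma subst_id: "x \<in> lists {..<k} \<Longrightarrow> subst k a x = x"
  by (auto simp: subst_def lists_eq_set intro!: map_idI)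

lemma subst_in_lists: "a < k \<Longrightarrow> subst k a x \<in> lists {..<k}"
  by (auto simp: subst_def lists_eq_set)

text \<open>With \<open>p\<close> a minimal idempotent on constant words, \<open>e = p \<odot> v \<odot> r\<close> is an idempotent with
  \<open>p \<odot> e = e = e \<odot> p\<close>; every substitution sends \<open>e\<close> to an idempotent below \<open>p\<close>, hence to \<open>p\<close>.
  Take \<open>q = v \<odot> r\<close>, which lives on words that start with the variable.\<close>

lemma variable_word_ultrafilters:
  fixes k :: nat
  shows "\<exists>p q. ultra p \<and> ultra q \<and> lists {..<k} \<in> p \<and> range (Cons k) \<in> q \<and>
    (\<forall>a<k. p \<odot> umap (subst k a) q = p) \<and>
    (\<forall>a<k. \<forall>b<k. umap (subst k a) q \<odot> umap (subst k b) q = umap (subst k a) q)"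
proof -
  define T0 where "T0 = {p. ultra p \<and> lists {..<k} \<in> p}"
  define T1 :: "nat list set set set" where "T1 = Collect ultra"
  define v where "v = {A. [k] \<in> A}"
  have cl0: "uclosed T0"
  proof -
    have "lists {..<k} \<in> p" if "ultra p" "\<forall>A\<in>p. \<exists>q\<in>T0. A \<in> q" for p
      using ultra_dichotomy[OF that(1), of "lists {..<k}"] that(2) ultra_Compl_iff
      unfolding T0_def by blast
    then show ?thesis unfolding uclosed_def T0_def by blast
  qed
  have ne0: "T0 \<noteq> {}" using ultra_principal[of "[]"] unfolding T0_def by auto
  have mul0: "x \<odot> y \<in> T0" if "x \<in> T0" "y \<in> T0" for x y
  proof -
    have ux: "ultra x" "lists {..<k} \<in> x" and uy: "ultra y" "lists {..<k} \<in> y"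
      using that by (auto simp: T0_def)
    have "{s. {t. s @ t \<in> lists {..<k}} \<in> y} \<in> x"
      by (rule ultra_mono[OF ux]) (auto intro: ultra_mono[OF uy])
    then show ?thesis using ultra_umul[OF ux(1) uy(1)] by (simp add: T0_def umul_def)
  qed
  have ex0: "\<exists>L. left_ideal T0 L \<and> (\<exists>e\<in>L. e \<odot> e = e) \<and> (\<forall>l\<in>L. (\<lambda>y. y \<odot> l) ` T0 = L)"
    by (rule minimal_left_ideal_exists[OF cl0 ne0]) (rule mul0)
  from ex0 obtain L where L0: "left_ideal T0 L \<and> (\<exists>e\<in>L. e \<odot> e = e) \<and> (\<forall>l\<in>L. (\<lambda>y. y \<odot> l) ` T0 = L)" ..
  then have L: "left_ideal T0 L" "\<forall>l\<in>L. (\<lambda>y. y \<odot> l) ` T0 = L" by simp_all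
  from L0 obtain p where p: "p \<in> L" "p \<odot> p = p" by (elim conjE bexE)
  have up: "ultra p" and p0: "lists {..<k} \<in> p" using L(1) p by (auto simp: left_ideal_def T0_def)
  \<comment> \<open>\<open>e = e \<odot> p\<close> lies in the left ideal \<open>L\<close>, so
    minimality writes \<open>p\<close> as \<open>z \<odot> e\<close>. Multiplying by the idempotent
    \<open>e\<close> gives \<open>p \<odot> e = p\<close>, while
    \<open>p \<odot> e = e\<close>.\<close>
  have uniq: "e = p" if e: "e \<in> T0" "e \<odot> e = e" "p \<odot> e = e" "e \<odot> p = e" for e
  proof -
    have "e \<in> L" using L(1) p(1) e(1,4) unfolding left_ideal_def by metis
    then obtain z where "z \<odot> e = p" using bspec[OF L(2), of e] p(1) by (metis imageE)
    then show ?thesis using e(2,3) umul_assoc[of z e e] by simp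
  qed
  \<comment> \<open>A second minimal left ideal is taken among all ultrafilters, because products
    with \<open>v\<close> leave \<open>T0\<close>.\<close>
  have cl1: "uclosed T1" unfolding uclosed_def T1_def by blast
  have ne1: "T1 \<noteq> {}" using ultra_principal[of "[]"] unfolding T1_def by auto
  have mul1: "x \<odot> y \<in> T1" if "x \<in> T1" "y \<in> T1" for x y
    using that ultra_umul unfolding T1_def by blast
  have ex1: "\<exists>L. left_ideal T1 L \<and> (\<exists>e\<in>L. e \<odot> e = e) \<and> (\<forall>l\<in>L. (\<lambda>y. y \<odot> l) ` T1 = L)"
    by (rule minimal_left_ideal_exists[OF cl1 ne1]) (rule mul1)
  from ex1 obtain M where M0: "left_ideal T1 M \<and> (\<exists>e\<in>M. e \<odot> e = e) \<and> (\<forall>l\<in>M. (\<lambda>y. y \<odot> l) ` T1 = M)" ..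
  then have M: "left_ideal T1 M" "\<forall>l\<in>M. (\<lambda>y. y \<odot> l) ` T1 = M" by simp_all
  from M0 obtain m where m: "m \<in> M" "m \<odot> m = m" by (elim conjE bexE)
  have uv: "ultra v" unfolding v_def by (rule ultra_principal)
  have um: "ultra m" using M(1) m by (auto simp: left_ideal_def T1_def)
  have "p \<odot> v \<odot> m \<in> M" using M(1) m up uv ultra_umul unfolding left_ideal_def T1_def by blast
  then have "m \<in> (\<lambda>y. y \<odot> (p \<odot> v \<odot> m)) ` T1" using bspec[OF M(2), of "p \<odot> v \<odot> m"] m(1) by simp
  then obtain z where z': "m = z \<odot> (p \<odot> v \<odot> m)" "z \<in> T1" by (rule imageE)
  have z: "ultra z" "z \<odot> (p \<odot> v \<odot> m) = m" using z' by (simp_all add: T1_def)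
  \<comment> \<open>In \<open>e \<odot> e\<close> the factor \<open>z\<close> cancels the
    \<open>p \<odot> v \<odot> m\<close> that follows it, by the choice of \<open>z\<close>. The
    final \<open>p\<close> makes \<open>q \<odot> p = q\<close>.\<close>
  define r where "r = m \<odot> z \<odot> p"
  define q where "q = v \<odot> r"
  define e where "e = p \<odot> q"
  have ur: "ultra r" unfolding r_def by (intro ultra_umul um z up)
  have uq: "ultra q" unfolding q_def by (intro ultra_umul uv ur)
  have "e \<odot> e = p \<odot> v \<odot> m \<odot> (z \<odot> ((p \<odot> p) \<odot> v \<odot> m)) \<odot> z \<odot> p"
    unfolding e_def q_def r_def by (simp only: umul_assoc)
  also have "\<dots> = p \<odot> v \<odot> (m \<odot> m) \<odot> z \<odot> p" using z(2) p(2) by (simp only: umul_assoc)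
  finally have ee: "e \<odot> e = e" using m(2) by (simp add: umul_assoc e_def q_def r_def)
  have qp: "q \<odot> p = q" using p(2) by (simp add: umul_assoc q_def r_def)
  have pe: "p \<odot> e = e" using p(2) by (simp add: umul_assoc[symmetric] e_def)
  have ep: "e \<odot> p = e" using qp by (simp add: umul_assoc e_def)
  have mp: "umap (subst k a) p = p" for a
  proof (rule sym, rule ultra_eqI[OF up ultra_umap[OF up]], rule subsetI)
    fix A assume "A \<in> p"
    then have "A \<inter> lists {..<k} \<in> p" using ultra_Int up p0 by blast
    moreover have "A \<inter> lists {..<k} \<subseteq> subst k a -` A"
      using subst_id by (metis IntE subsetI vimageI2)
    ultimately show "A \<in> umap (subst k a) p"
      unfolding umap_def using ultra_mono[OF up] by blast
  qed
  have hom: "umap (subst k a) (x \<odot> y) = umap (subst k a) x \<odot> umap (subst k a) y" for a x y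
    by (rule umap_umul) (rule subst_append)
  have ea: "umap (subst k a) e = p" if "a < k" for a
  proof (rule uniq)
    have "subst k a -` lists {..<k} = UNIV" using subst_in_lists[OF that] by blast
    moreover have ue: "ultra e" unfolding e_def by (intro ultra_umul up uq)
    ultimately show "umap (subst k a) e \<in> T0"
      using ultra_umap[OF ue] ultra_UNIV[OF ue] by (simp add: T0_def umap_def)
  qed (use hom[of a] ee pe ep mp[of a] in metis)+
  have pq: "p \<odot> umap (subst k a) q = p" if "a < k" for a
    using ea[OF that] hom[of a p q] mp[of a] by (simp add: e_def)
  \<comment> \<open>By \<open>q = q \<odot> p\<close> the first factor ends in \<open>p\<close>,
    which absorbs the second factor.\<close>
  have "umap (subst k a) q \<odot> umap (subst k b) q = umap (subst k a) q" if "a < k" "b < k" for a b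
  proof -
    have "umap (subst k a) q = umap (subst k a) q \<odot> p"
      using hom[of a q p] mp[of a] qp by simp
    then show ?thesis using pq[OF that(2)] umul_assoc by metis
  qed
  moreover have "range (Cons k) \<in> q"
    using ultra_UNIV[OF ur] by (simp add: q_def umul_def v_def)
  ultimately show ?thesis using up uq p0 pq by blast
qed

section \<open>Rigid surjections and the Carlson--Simpson lemma\<close>

text \<open>Formulated without minima of preimages, so that it also makes sense for words with
  finite range, where some preimages are empty.\<close>

definition rigid :: "(nat \<Rightarrow> nat) \<Rightarrow> bool" where
  "rigid h \<longleftrightarrow> (\<forall>i. \<forall>y<h i. \<exists>i'<i. h i' = y)"

definition rsurj :: "(nat \<Rightarrow> nat) \<Rightarrow> bool" where
  "rsurj h \<longleftrightarrow> surj h \<and> rigid h"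

lemma rigidD: "rigid h \<Longrightarrow> y < h i \<Longrightarrow> \<exists>i'<i. h i' = y"
  unfolding rigid_def by blast

lemma rigid_comp: "rigid g \<Longrightarrow> rigid h \<Longrightarrow> rigid (g \<circ> h)"
  unfolding rigid_def comp_def by metis

lemma rsurj_comp: "rsurj g \<Longrightarrow> rsurj h \<Longrightarrow> rsurj (g \<circ> h)"
  unfolding rsurj_def using rigid_comp comp_surj by blast

lemma rsurj_id: "rsurj id"
  by (auto simp: rsurj_def rigid_def)

lemma rigid_le: "rigid h \<Longrightarrow> h i \<le> i"
proof (induction i rule: less_induct)
  case (less i)
  show ?case
  proof (cases "h i")
    case (Suc y)
    then obtain i' where "i' < i" "h i' = y" using less.prems unfolding rigid_def by (metis lessI)
    then show ?thesis using less Suc by (metis Suc_leI le_less_trans)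
  qed simp
qed

lemma rigid_before_first:
  assumes "rigid h" "\<forall>i<N. h i \<noteq> h N" "i < N"
  shows "h i < h N"
  using assms unfolding rigid_def by (metis linorder_neqE_nat order_less_trans)

lemma rsurj_first_occurrence:
  assumes "rsurj h"
  shows "\<exists>N. h N = p \<and> (\<forall>i<N. h i < p)"
proof -
  have "\<exists>N. h N = p" using assms unfolding rsurj_def surj_def by metis
  then obtain N where "h N = p" "\<forall>i<N. h i \<noteq> p" using exists_least_iff[of "\<lambda>N. h N = p"] by blast
  then show ?thesis using rigid_before_first[of h N] assms unfolding rsurj_def by metis
qed

lemma rsurj_imp_RSurj:
  assumes "rsurj h"
  shows "h \<in> RSurj"
proof -
  have "(LEAST x. x \<in> h -` {y1}) < (LEAST x. x \<in> h -` {y2})" if "y1 < y2" for y1 y2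
  proof -
    obtain N where N: "h N = y2" "\<forall>i<N. h i < y2" using rsurj_first_occurrence[OF assms] by blast
    have "h (LEAST x. x \<in> h -` {y2}) = y2"
      using LeastI[of "\<lambda>x. x \<in> h -` {y2}" N] N by simp
    then have "\<exists>i'<(LEAST x. x \<in> h -` {y2}). h i' = y1"
      using assms that unfolding rsurj_def rigid_def by simp
    then obtain i' where "i' < (LEAST x. x \<in> h -` {y2})" "h i' = y1" by blast
    then show ?thesis using Least_le[of "\<lambda>x. x \<in> h -` {y1}" i'] by simp
  qed
  then show ?thesis using assms unfolding RSurj_def rsurj_def by blast
qed

lemma rsurj_from_prefixes:
  fixes l :: "nat \<Rightarrow> nat list"
  assumes l0: "l 0 = [0..<k] @ x" "x \<in> lists {..<k}"
    and step: "\<And>n. \<exists>y\<in>lists {..k + n}. l (Suc n) = l n @ (k + n) # y"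
  shows "\<exists>g. rsurj g \<and> (\<forall>i<k. g i = i) \<and> (\<forall>n. map g [0..<length (l n)] = l n) \<and>
    (\<forall>n. g (length (l n)) = k + n) \<and> (\<forall>n. \<forall>i<length (l n). g i < k + n)"
proof -
  \<comment> \<open>Each step adds at least one letter, so \<open>l (Suc i)\<close> has an entry at
    position \<open>i\<close>.\<close>
  define g where "g i = l (Suc i) ! i" for i
  have inv: "(\<forall>i<length (l n). l n ! i < k + n \<and> (\<forall>y<l n ! i. \<exists>i'<i. l n ! i' = y)) \<and>
      (\<forall>y<k + n. \<exists>i<length (l n). l n ! i = y)" for n
  proof (induction n)
    case 0
    have v: "l 0 ! i = i" if "i < k" for i using that l0 by (simp add: nth_append)
    have "l 0 ! i < k \<and> (\<forall>y<l 0 ! i. \<exists>i'<i. l 0 ! i' = y)" if "i < length (l 0)" for i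
    proof (cases "i < k")
      case True
      then show ?thesis using v by auto
    next
      case False
      then have "l 0 ! i = x ! (i - k)" "i - k < length x" using that l0 by (auto simp: nth_append)
      then have "l 0 ! i < k" using l0(2) by (metis in_listsD lessThan_iff nth_mem)
      then show ?thesis using v False by (metis leI less_le_trans order_less_trans)
    qed
    moreover have "\<exists>i<length (l 0). l 0 ! i = y" if "y < k" for y
      using that v l0 by (intro exI[of _ y]) auto
    ultimately show ?case by simp
  next
    case (Suc n)
    obtain y where y: "y \<in> lists {..k + n}" "l (Suc n) = l n @ (k + n) # y" using step by blast
    have old: "l (Suc n) ! i = l n ! i" if "i < length (l n)" for i
      using that y by (simp add: nth_append)
    have mid: "l (Suc n) ! length (l n) = k + n" using y by simp
    have occ: "\<exists>i'<length (l n). l (Suc n) ! i' = v" if "v < k + n" for v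
      using Suc that old by metis
    have "l (Suc n) ! i < k + Suc n \<and> (\<forall>v<l (Suc n) ! i. \<exists>i'<i. l (Suc n) ! i' = v)"
      if i: "i < length (l (Suc n))" for i
    proof (cases "i < length (l n)")
      case True
      then show ?thesis using Suc old by (metis add_Suc_right less_Suc_eq order_less_trans)
    next
      case False
      then have "l (Suc n) ! i = ((k + n) # y) ! (i - length (l n))"
        "i - length (l n) < length ((k + n) # y)" using i y by (auto simp: nth_append)
      then have "l (Suc n) ! i \<in> set ((k + n) # y)" by (metis nth_mem)
      then have le: "l (Suc n) ! i \<le> k + n" using y(1) by auto
      then have "\<exists>i'<i. l (Suc n) ! i' = v" if "v < l (Suc n) ! i" for v
        using occ[of v] that False by (metis leI less_le_trans)
      then show ?thesis using le by simp
    qed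
    moreover have "\<exists>i<length (l (Suc n)). l (Suc n) ! i = v" if "v < k + Suc n" for v
    proof (cases "v = k + n")
      case True
      then show ?thesis using mid y by (intro exI[of _ "length (l n)"]) auto
    next
      case False
      then have "v < k + n" using that by simp
      then obtain i where "i < length (l n)" "l (Suc n) ! i = v" using occ by blast
      then show ?thesis using y by (intro exI[of _ i]) auto
    qed
    ultimately show ?case by blast
  qed
  have len: "n \<le> length (l n)" for n
  proof (induction n)
    case (Suc n)
    then show ?case using step[of n] by auto
  qed simp
  have mono: "i < length (l n') \<and> l n' ! i = l n ! i" if "n \<le> n'" "i < length (l n)" for i n n'
    using that(1)
  proof (induction n' rule: dec_induct)
    case (step n')
    then show ?case using assms(3)[of n'] by (auto simp: nth_append)
  qed (use that in simp)
  have g: "g i = l n ! i" if "i < length (l n)" for i n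
    using mono[of n "Suc i" i] mono[of "Suc i" n i] len[of "Suc i"] that unfolding g_def
    by (metis Suc_le_lessD nat_le_linear)
  have gmap: "map g [0..<length (l n)] = l n" for n
    by (rule nth_equalityI) (simp_all add: g)
  have glen: "g (length (l n)) = k + n" for n
  proof -
    obtain y where "l (Suc n) = l n @ (k + n) # y" using step by blast
    then show ?thesis using g[of "length (l n)" "Suc n"] by simp
  qed
  have glt: "g i < k + n" if "i < length (l n)" for i n
    using inv[of n] g that by metis
  have "rigid g"
    unfolding rigid_def
  proof (intro allI impI)
    fix i y assume "y < g i"
    moreover have i: "i < length (l (Suc i))" using len[of "Suc i"] by simp
    ultimately obtain i' where "i' < i" "l (Suc i) ! i' = y" using inv[of "Suc i"] g by metis
    then show "\<exists>i'<i. g i' = y" using g[of i' "Suc i"] i by auto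
  qed
  moreover have "\<exists>i. g i = y" for y
  proof -
    have "y < k + Suc y" by simp
    then obtain i where "i < length (l (Suc y))" "l (Suc y) ! i = y" using inv[of "Suc y"] by blast
    then show ?thesis using g[of i "Suc y"] by (intro exI[of _ i]) simp
  qed
  then have "surj g" unfolding surj_def by metis
  moreover have "g i = i" if "i < k" for i
    using g[of i 0] that l0 by (simp add: nth_append)
  ultimately show ?thesis using gmap glen glt unfolding rsurj_def by blast
qed

text \<open>The colour is the one whose class belongs to \<open>p\<close>. The identity
  \<open>p \<odot> umap (subst k a) q = p\<close> yields a first \<open>good\<close> word; the other
  identity for \<open>q\<close> says that appending \<open>q\<close>-most instances of a block keeps
  a word \<open>good\<close>, so blocks can be appended forever. As a block opens with its new
  letter, the first letter of \<open>w \<circ> g\<close> outside the constants opens a block, and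
  what precedes it is an instance of some \<open>u n\<close>. The letters at positions below
  \<open>k\<close> are the same for all \<open>w\<close> and are left out of the coloured
  word.\<close>

lemma carlson_simpson:
  fixes D :: "nat list \<Rightarrow> nat"
  assumes D: "\<And>z. D z < K" and k: "0 < k"
  shows "\<exists>g col. rsurj g \<and> (\<forall>i<k. g i = i) \<and>
    (\<forall>w N. (\<forall>i<k. w i = i) \<longrightarrow> k \<le> N \<longrightarrow> (\<forall>i<N. w (g i) < k) \<longrightarrow> k \<le> w (g N) \<longrightarrow>
       D (map (w \<circ> g) [k..<N]) = col)"
proof -
  obtain p q where up: "ultra p" and uq: "ultra q" and p0: "lists {..<k} \<in> p"
    and qk: "range (Cons k) \<in> q"
    and pq: "\<And>a. a < k \<Longrightarrow> p \<odot> umap (subst k a) q = p"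
    and qq: "\<And>a b. a < k \<Longrightarrow> b < k \<Longrightarrow> umap (subst k a) q \<odot> umap (subst k b) q = umap (subst k a) q"
    using variable_word_ultrafilters[of k] by (elim exE conjE) simp
  have "\<exists>col. {z. D z = col} \<in> p"
  proof (rule ccontr)
    assume "\<nexists>col. {z. D z = col} \<in> p"
    then have "{z. D z \<noteq> i} \<in> p" for i
      using ultra_Compl_iff[OF up, of "{z. D z = i}"] by (simp add: Collect_neg_eq)
    then have "{z. \<forall>i\<in>{..<K}. D z \<noteq> i} \<in> p" by (intro ultra_finite_INT[OF up]) auto
    moreover have "{z. \<forall>i\<in>{..<K}. D z \<noteq> i} = {}" using D by auto
    ultimately show False using ultra_empty[OF up] by simp
  qed
  then obtain col where col: "{z. D z = col} \<in> p" by blast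
  define C where "C = {z. D z = col}"
  define good where "good w \<longleftrightarrow> w \<in> C \<and> (\<forall>a\<in>{..<k}. {y. w @ subst k a y \<in> C} \<in> q)" for w
  have "{w. {y. w @ subst k a y \<in> C} \<in> q} \<in> p" if "a \<in> {..<k}" for a
    using pq[of a] col that unfolding C_def[symmetric] by (auto simp: umul_def umap_def vimage_def)
  then have "{w. \<forall>a\<in>{..<k}. {y. w @ subst k a y \<in> C} \<in> q} \<in> p"
    by (intro ultra_finite_INT[OF up]) auto
  then have "C \<inter> {w. \<forall>a\<in>{..<k}. {y. w @ subst k a y \<in> C} \<in> q} \<inter> lists {..<k} \<in> p"
    using col p0 ultra_Int[OF up] unfolding C_def by blast
  then have "C \<inter> {w. \<forall>a\<in>{..<k}. {y. w @ subst k a y \<in> C} \<in> q} \<inter> lists {..<k} \<noteq> {}"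
    using ultra_empty[OF up] by metis
  then obtain x where x: "good x" "x \<in> lists {..<k}" unfolding good_def by blast
  have ext1: "{y. good (w @ subst k a y)} \<in> q" if w: "good w" and a: "a \<in> {..<k}" for w a
  proof -
    have 1: "{y. w @ subst k a y \<in> C} \<in> q" using w a unfolding good_def by blast
    have "{x. {y. w @ subst k a x @ subst k b y \<in> C} \<in> q} \<in> q" if b: "b \<in> {..<k}" for b
    proof -
      have "{y. w @ y \<in> C} \<in> umap (subst k a) q" using 1 by (simp add: umap_def vimage_def)
      then have "{y. w @ y \<in> C} \<in> umap (subst k a) q \<odot> umap (subst k b) q" using qq a b by simp
      then show ?thesis by (simp add: umap_def umul_def vimage_def)
    qed
    then have "{x. \<forall>b\<in>{..<k}. {y. w @ subst k a x @ subst k b y \<in> C} \<in> q} \<in> q"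
      by (intro ultra_finite_INT[OF uq]) auto
    then have "{y. w @ subst k a y \<in> C} \<inter> {x. \<forall>b\<in>{..<k}. {y. w @ subst k a x @ subst k b y \<in> C} \<in> q} \<in> q"
      using 1 ultra_Int[OF uq] by blast
    then show ?thesis by (simp add: good_def Collect_conj_eq)
  qed
  define fixing where "fixing w \<longleftrightarrow> (\<forall>i<k. w i = i) \<and> range w \<subseteq> {..<k}" for w :: "nat \<Rightarrow> nat"
  have "\<exists>u. \<forall>n. (\<forall>w. fixing w \<longrightarrow> good (map w (u n))) \<and> (n = 0 \<longrightarrow> u n = x) \<and>
      (\<exists>y\<in>lists {..k + n}. u (Suc n) = u n @ (k + n) # y)"
  proof -
    have "map w x = x" if "fixing w" for w
      using that x(2) unfolding fixing_def by (auto intro!: map_idI)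
    then have "\<exists>u. (\<forall>w. fixing w \<longrightarrow> good (map w u)) \<and> ((0::nat) = 0 \<longrightarrow> u = x)"
      using x by (intro exI[of _ x]) auto
    moreover have "\<exists>u'. ((\<forall>w. fixing w \<longrightarrow> good (map w u')) \<and> (Suc n = 0 \<longrightarrow> u' = x)) \<and>
        (\<exists>y\<in>lists {..k + n}. u' = u @ (k + n) # y)"
      if u: "(\<forall>w. fixing w \<longrightarrow> good (map w u)) \<and> (n = 0 \<longrightarrow> u = x)" for u n
    proof -
      \<comment> \<open>The instances of \<open>u\<close> have a fixed length over \<open>k\<close>
        letters, so they are finitely many, and one block can serve all of them together with all
        values of the new letter.\<close>
      let ?F = "{map w u |w. fixing w}"
      have "?F \<subseteq> {xs. set xs \<subseteq> {..<k} \<and> length xs = length u}" by (fastforce simp: fixing_def)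
      then have fin: "finite (?F \<times> {..<k})"
        using finite_lists_length_eq[of "{..<k}" "length u"] finite_subset by blast
      have "{y. \<forall>za\<in>?F \<times> {..<k}. good (fst za @ subst k (snd za) y)} \<in> q"
        by (rule ultra_finite_INT[OF uq fin], rule ext1) (use u in auto)
      then have "{y. \<forall>za\<in>?F \<times> {..<k}. good (fst za @ subst k (snd za) y)} \<inter> range (Cons k) \<in> q"
        using qk ultra_Int[OF uq] by blast
      then have "{y. \<forall>za\<in>?F \<times> {..<k}. good (fst za @ subst k (snd za) y)} \<inter> range (Cons k) \<noteq> {}"
        using ultra_empty[OF uq] by metis
      then obtain y where y: "\<forall>za\<in>?F \<times> {..<k}. good (fst za @ subst k (snd za) (k # y))" by auto
      \<comment> \<open>Renames the variable of the block to \<open>k + n\<close>; applying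
        \<open>w\<close> afterwards is the substitution of the constant
        \<open>w (k + n)\<close>.\<close>
      let ?s = "\<lambda>i. if i < k then i else k + n"
      have "good (map w (u @ map ?s (k # y)))" if w: "fixing w" for w
      proof -
        have "map w (map ?s (k # y)) = subst k (w (k + n)) (k # y)"
          using w unfolding fixing_def subst_def by auto
        moreover have "(map w u, w (k + n)) \<in> ?F \<times> {..<k}" using w unfolding fixing_def by auto
        then have "good (fst (map w u, w (k + n)) @ subst k (snd (map w u, w (k + n))) (k # y))"
          by (rule bspec[OF y])
        ultimately show ?thesis by (simp only: map_append fst_conv snd_conv)
      qed
      then show ?thesis by (intro exI[of _ "u @ map ?s (k # y)"]) auto
    qed
    ultimately have "\<exists>f. \<forall>n. ((\<forall>w. fixing w \<longrightarrow> good (map w (f n))) \<and> (n = 0 \<longrightarrow> f n = x)) \<and>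
        (\<exists>y\<in>lists {..k + n}. f (Suc n) = f n @ (k + n) # y)"
      by (rule dependent_nat_choice)
    then show ?thesis by (simp only: conj_assoc)
  qed
  then obtain u where u': "\<forall>n. (\<forall>w. fixing w \<longrightarrow> good (map w (u n))) \<and> (n = 0 \<longrightarrow> u n = x) \<and>
      (\<exists>y\<in>lists {..k + n}. u (Suc n) = u n @ (k + n) # y)" ..
  have u: "good (map w (u n))" if "fixing w" for n w using u' that by simp
  have u0: "u 0 = x" using u' by simp
  have u_Suc: "\<exists>y\<in>lists {..k + n}. u (Suc n) = u n @ (k + n) # y" for n using u' by simp
  define l where "l n = [0..<k] @ u n" for n
  have "\<exists>g. rsurj g \<and> (\<forall>i<k. g i = i) \<and> (\<forall>n. map g [0..<length (l n)] = l n) \<and>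
    (\<forall>n. g (length (l n)) = k + n) \<and> (\<forall>n. \<forall>i<length (l n). g i < k + n)"
  proof (rule rsurj_from_prefixes)
    show "\<exists>y\<in>lists {..k + n}. l (Suc n) = l n @ (k + n) # y" for n
      using u_Suc[of n] by (auto simp: l_def)
  qed (use u0 x in \<open>auto simp: l_def\<close>)
  then obtain g where g: "rsurj g" "\<forall>i<k. g i = i" "\<And>n. map g [0..<length (l n)] = l n"
    "\<And>n. g (length (l n)) = k + n" "\<And>n i. i < length (l n) \<Longrightarrow> g i < k + n" by blast
  have "D (map (w \<circ> g) [k..<N]) = col"
    if w: "\<forall>i<k. w i = i" "k \<le> N" "\<forall>i<N. w (g i) < k" "k \<le> w (g N)" for w N
  proof -
    have gN: "k \<le> g N" using w(1,4) by (metis leI le_antisym less_or_eq_imp_le)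
    define n where "n = g N - k"
    \<comment> \<open>\<open>N\<close> must be the first position of the letter \<open>g N\<close>:
      an earlier occurrence would already have produced the value \<open>w (g N)\<close>, which is
      not below \<open>k\<close>.\<close>
    have "\<not> length (l n) < N" using w(3,4) g(4)[of n] gN unfolding n_def by auto
    moreover have "\<not> N < length (l n)" using g(5)[of N n] gN unfolding n_def by auto
    ultimately have N: "N = length (l n)" by simp
    \<comment> \<open>Makes \<open>w\<close> a substitution of constants. The default 0 is harmless,
      since before position \<open>N\<close> only values below \<open>k\<close> occur.\<close>
    define w' where "w' i = (if w i < k then w i else 0)" for i
    have "fixing w'" unfolding fixing_def w'_def using w(1) k by auto
    moreover have "map (w \<circ> g) [k..<N] = map w' (u n)"
    proof -
      have "map (w \<circ> g) [k..<N] = map (w' \<circ> g) [k..<N]"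
        using w(3) unfolding w'_def by auto
      also have "\<dots> = map w' (drop k (map g [0..<length (l n)]))"
        using N by (simp add: drop_map)
      also have "\<dots> = map w' (u n)" unfolding g(3) by (simp add: l_def)
      finally show ?thesis .
    qed
    ultimately have "good (map (w \<circ> g) [k..<N])" using u by simp
    then show ?thesis unfolding good_def C_def by blast
  qed
  then show ?thesis using g(1,2) by blast
qed

section \<open>Borel colourings of infinite words\<close>

definition cylinder :: "nat \<Rightarrow> nat list \<Rightarrow> (nat \<Rightarrow> nat) set" where
  "cylinder k s = {z. range z \<subseteq> {..<k} \<and> map z [0..<length s] = s}"

text \<open>A set of finite words closed under extension stands for an open set of infinite words.\<close>

definition dense_open :: "nat \<Rightarrow> nat list set \<Rightarrow> bool" where
  "dense_open k U \<longleftrightarrow>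
     (\<forall>s\<in>lists {..<k}. \<exists>t\<in>lists {..<k}. s @ t \<in> U) \<and> (\<forall>s\<in>U. \<forall>t. s @ t \<in> U)"

definition generic :: "(nat \<Rightarrow> nat list set) \<Rightarrow> (nat \<Rightarrow> nat) set" where
  "generic U = {z. \<forall>n. \<exists>l. map z [0..<l] \<in> U n}"

definition decides :: "nat \<Rightarrow> (nat \<Rightarrow> nat) set \<Rightarrow> nat list \<Rightarrow> (nat \<Rightarrow> nat) set \<Rightarrow> bool" where
  "decides k G s B \<longleftrightarrow> cylinder k s \<inter> G \<subseteq> B \<or> cylinder k s \<inter> G \<inter> B = {}"

text \<open>The Baire property in the space of infinite words over \<open>k\<close> letters: on a
  comeagre set, here \<open>generic U\<close>, the set \<open>B\<close> is full or empty in densely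
  many cylinders.\<close>

definition baire_property :: "nat \<Rightarrow> (nat \<Rightarrow> nat) set \<Rightarrow> bool" where
  "baire_property k B \<longleftrightarrow> (\<exists>U. (\<forall>n. dense_open k (U n)) \<and>
     (\<forall>s\<in>lists {..<k}. \<exists>t\<in>lists {..<k}. decides k (generic U) (s @ t) B))"

lemma cylinder_append: "cylinder k (s @ t) \<subseteq> cylinder k s"
proof
  fix z assume z: "z \<in> cylinder k (s @ t)"
  then have "take (length s) (map z [0..<length (s @ t)]) = take (length s) (s @ t)"
    unfolding cylinder_def by simp
  then show "z \<in> cylinder k s" using z by (simp add: cylinder_def take_map)
qed

lemma decides_mono: "decides k G s B \<Longrightarrow> G' \<subseteq> G \<Longrightarrow> decides k G' (s @ t) B"
  using cylinder_append[of k s t] unfolding decides_def by blast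

lemma decides_Compl: "decides k G s (UNIV - B) \<longleftrightarrow> decides k G s B"
  unfolding decides_def by blast

lemma map_upt_split: "l \<le> l' \<Longrightarrow> map z [0..<l'] = map z [0..<l] @ map z [l..<l']"
  using upt_add_eq_append[of 0 l "l' - l"] by simp

lemma open_contains_cylinder:
  fixes S :: "(nat \<Rightarrow> nat) set"
  assumes "open S" "z \<in> S"
  shows "\<exists>N. \<forall>z'. (\<forall>i<N. z' i = z i) \<longrightarrow> z' \<in> S"
proof -
  have "openin (product_topology (\<lambda>i. euclidean) UNIV) S" using assms(1) by (simp add: open_fun_def)
  then obtain X where X: "z \<in> (\<Pi>\<^sub>E i\<in>UNIV. X i)" "finite {i. X i \<noteq> topspace euclidean}"
    "(\<Pi>\<^sub>E i\<in>UNIV. X i) \<subseteq> S"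
    using product_topology_open_contains_basis[of "\<lambda>i. euclidean" UNIV S z] assms(2) by auto
  obtain N where N: "\<forall>i\<in>{i. X i \<noteq> topspace euclidean}. i < N"
    using X(2) finite_nat_set_iff_bounded by blast
  have "z' \<in> S" if "\<forall>i<N. z' i = z i" for z'
  proof -
    have "z' i \<in> X i" for i
      using N X(1) that by (cases "i < N") (auto simp: PiE_def Pi_def)
    then show ?thesis using X(3) by (auto simp: PiE_def)
  qed
  then show ?thesis by blast
qed

lemma generic_merge:
  fixes V :: "nat \<Rightarrow> nat \<Rightarrow> nat list set"
  assumes "\<And>i n. dense_open k (V i n)"
  shows "\<exists>U. (\<forall>n. dense_open k (U n)) \<and> (\<forall>i. generic U \<subseteq> generic (V i))"
proof (intro exI conjI allI)
  let ?U = "\<lambda>n. V (fst (prod_decode n)) (snd (prod_decode n))"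
  show "dense_open k (?U n)" for n by (rule assms)
  show "generic ?U \<subseteq> generic (V i)" for i
  proof
    fix z assume "z \<in> generic ?U"
    then have "\<exists>l. map z [0..<l] \<in> ?U (prod_encode (i, n))" for n unfolding generic_def by blast
    then show "z \<in> generic (V i)" unfolding generic_def by simp
  qed
qed

lemma baire_property_open:
  assumes "open S"
  shows "baire_property k S"
proof -
  have "\<exists>t\<in>lists {..<k}. decides k (generic (\<lambda>_. UNIV)) (s @ t) S" if s: "s \<in> lists {..<k}" for s
  proof (cases "cylinder k s \<inter> S = {}")
    case True
    then have "decides k (generic (\<lambda>_. UNIV)) (s @ []) S" unfolding decides_def by auto
    then show ?thesis by blast
  next
    case False
    then obtain z where z: "z \<in> cylinder k s" "z \<in> S" by blast
    obtain N where N: "\<forall>z'. (\<forall>i<N. z' i = z i) \<longrightarrow> z' \<in> S"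
      using open_contains_cylinder[OF assms z(2)] by blast
    let ?l = "max N (length s)"
    let ?t = "map z [length s..<?l]"
    have st: "s @ ?t = map z [0..<?l]"
      using map_upt_split[of "length s" ?l z] z(1) by (simp add: cylinder_def)
    have "cylinder k (s @ ?t) \<subseteq> S"
    proof
      fix z' assume "z' \<in> cylinder k (s @ ?t)"
      then have "map z' [0..<?l] = map z [0..<?l]" unfolding cylinder_def st by simp
      then have "\<forall>i<?l. z' i = z i" by (auto simp: map_eq_conv)
      then show "z' \<in> S" using N by simp
    qed
    then have "decides k (generic (\<lambda>_. UNIV)) (s @ ?t) S" unfolding decides_def by blast
    moreover have "?t \<in> lists {..<k}" using z(1) by (auto simp: cylinder_def subset_iff)
    ultimately show ?thesis by blast
  qed
  moreover have "dense_open k UNIV" unfolding dense_open_def by blast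
  ultimately show ?thesis
    unfolding baire_property_def by (intro exI[of _ "\<lambda>_. UNIV"] conjI) auto
qed

text \<open>The words that decide \<open>B i\<close> form a dense open set \<open>E i\<close>, which
  is added to the generic conditions. If no extension of \<open>s\<close> forces generic words into
  some \<open>B i\<close>, then a generic word in the cylinder of \<open>s\<close>, having a prefix
  in each \<open>E i\<close>, is forced out of every \<open>B i\<close>.\<close>

lemma baire_property_UN:
  fixes B :: "nat \<Rightarrow> (nat \<Rightarrow> nat) set"
  assumes "\<And>i. baire_property k (B i)"
  shows "baire_property k (\<Union>i. B i)"
proof -
  obtain V where V: "\<And>i n. dense_open k (V i n)"
    "\<And>i s. s \<in> lists {..<k} \<Longrightarrow> \<exists>t\<in>lists {..<k}. decides k (generic (V i)) (s @ t) (B i)"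
    using assms unfolding baire_property_def by metis
  define E where "E i = {s. decides k (generic (V i)) s (B i)}" for i
  have E: "dense_open k (E i)" for i
    using V(2)[of _ i] decides_mono[of k _ _ "B i" "generic (V i)"]
    unfolding dense_open_def E_def by blast
  define V' where "V' i n = (case n of 0 \<Rightarrow> E i | Suc n \<Rightarrow> V i n)" for i n
  have "dense_open k (V' i n)" for i n using V(1) E unfolding V'_def by (cases n) auto
  then obtain U where U: "\<And>n. dense_open k (U n)" "\<And>i. generic U \<subseteq> generic (V' i)"
    using generic_merge by metis
  have V'0: "z \<in> generic (V i) \<and> (\<exists>l. map z [0..<l] \<in> E i)" if "z \<in> generic U" for z i
  proof -
    have z: "\<exists>l. map z [0..<l] \<in> V' i n" for n using U(2)[of i] that unfolding generic_def by blast
    show ?thesis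
      using z[of 0] z[of "Suc n" for n] unfolding V'_def generic_def by simp
  qed
  have "\<exists>t\<in>lists {..<k}. decides k (generic U) (s @ t) (\<Union>i. B i)" if s: "s \<in> lists {..<k}" for s
  proof (cases "\<exists>i. \<exists>t\<in>lists {..<k}. cylinder k (s @ t) \<inter> generic (V i) \<subseteq> B i")
    case True
    then obtain i t where "t \<in> lists {..<k}" "cylinder k (s @ t) \<inter> generic (V i) \<subseteq> B i" by blast
    moreover have "generic U \<subseteq> generic (V i)" using V'0 by blast
    ultimately have "decides k (generic U) (s @ t) (\<Union>i. B i)" unfolding decides_def by blast
    then show ?thesis using \<open>t \<in> lists {..<k}\<close> by blast
  next
    case False
    have "z \<notin> B i" if z: "z \<in> cylinder k s" "z \<in> generic U" for z i
    proof
      assume zB: "z \<in> B i"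
      obtain l where l: "map z [0..<l] \<in> E i" using V'0[OF z(2)] by blast
      let ?l = "max l (length s)"
      let ?t = "map z [length s..<?l]"
      have "map z [0..<?l] \<in> E i"
        using map_upt_split[of l ?l z] l E[of i] unfolding dense_open_def by simp
      moreover have st: "map z [0..<?l] = s @ ?t"
        using map_upt_split[of "length s" ?l z] z(1) by (simp add: cylinder_def)
      moreover have "?t \<in> lists {..<k}" using z(1) by (auto simp: cylinder_def subset_iff)
      ultimately have "cylinder k (s @ ?t) \<inter> generic (V i) \<inter> B i = {}"
        using False unfolding E_def decides_def by auto
      moreover have "z \<in> cylinder k (s @ ?t)"
        using z(1) unfolding st[symmetric] by (simp add: cylinder_def)
      ultimately show False using zB V'0[OF z(2)] by blast
    qed
    then have "decides k (generic U) (s @ []) (\<Union>i. B i)" unfolding decides_def by auto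
    then show ?thesis by blast
  qed
  then show ?thesis using U(1) unfolding baire_property_def by blast
qed

lemma baire_property_borel:
  assumes "B \<in> sets borel"
  shows "baire_property k B"
proof -
  have "B \<in> sigma_sets UNIV {S. open S}" using assms by (simp add: borel_def)
  then show ?thesis
  proof (induction rule: sigma_sets.induct)
    case (Basic S)
    then show ?case using baire_property_open by simp
  next
    case Empty
    show ?case using baire_property_open[of "{}"] by simp
  next
    case (Compl S)
    then show ?case
      unfolding baire_property_def by (simp add: decides_Compl)
  next
    case (Union B)
    then show ?case by (intro baire_property_UN) auto
  qed
qed

text \<open>The finitely many colour classes are decided one after another by lengthening
  \<open>t\<close>; decisions persist under extension.\<close>

lemma borel_coloring_locally_constant:
  fixes c :: "(nat \<Rightarrow> nat) \<Rightarrow> nat"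
  assumes c: "c \<in> borel \<rightarrow>\<^sub>M count_space UNIV" and K: "\<And>z. c z < K" and s: "s \<in> lists {..<k}"
  shows "\<exists>U. (\<forall>n. dense_open k (U n)) \<and> (\<exists>t\<in>lists {..<k}.
    \<forall>z\<in>cylinder k (s @ t) \<inter> generic U. \<forall>z'\<in>cylinder k (s @ t) \<inter> generic U. c z = c z')"
proof -
  have "baire_property k (c -` {i})" for i
    using measurable_sets[OF c, of "{i}"] by (intro baire_property_borel) simp
  then obtain V where V: "\<And>i n. dense_open k (V i n)"
    "\<And>i s. s \<in> lists {..<k} \<Longrightarrow> \<exists>t\<in>lists {..<k}. decides k (generic (V i)) (s @ t) (c -` {i})"
    unfolding baire_property_def by metis
  obtain U where U: "\<And>n. dense_open k (U n)" "\<And>i. generic U \<subseteq> generic (V i)"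
    using generic_merge V(1) by metis
  have "\<exists>t\<in>lists {..<k}. \<forall>i<K. decides k (generic U) (s @ t) (c -` {i})" for K
  proof (induction K)
    case 0
    show ?case by (intro bexI[of _ "[]"]) auto
  next
    case (Suc K)
    then obtain t where t: "t \<in> lists {..<k}" "\<forall>i<K. decides k (generic U) (s @ t) (c -` {i})" by blast
    then obtain t' where t': "t' \<in> lists {..<k}" "decides k (generic (V K)) ((s @ t) @ t') (c -` {K})"
      using V(2)[of "s @ t" K] s by auto
    have "decides k (generic U) ((s @ t) @ t') (c -` {i})" if "i < Suc K" for i
    proof (cases "i = K")
      case True
      then show ?thesis using decides_mono[OF t'(2) U(2), of "[]"] by simp
    next
      case False
      then show ?thesis using that t(2) decides_mono[of k "generic U" "s @ t" _ _ t'] by auto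
    qed
    then show ?case using t(1) t'(1) by (intro bexI[of _ "t @ t'"]) auto
  qed
  then obtain t where t: "t \<in> lists {..<k}" "\<forall>i<K. decides k (generic U) (s @ t) (c -` {i})" by blast
  have "c z = c z'" if "z \<in> cylinder k (s @ t) \<inter> generic U" "z' \<in> cylinder k (s @ t) \<inter> generic U" for z z'
    using t(2)[rule_format, OF K[of z]] that unfolding decides_def by auto
  then show ?thesis using U(1) t(1) by blast
qed

lemma dense_open_uniform_extension:
  assumes U: "dense_open k U" and "finite F" "F \<subseteq> lists {..<k}"
  shows "\<exists>t\<in>lists {..<k}. \<forall>f\<in>F. f @ t \<in> U"
  using assms(2,3)
proof (induction F rule: finite_induct)
  case (insert f F)
  then obtain t where t: "t \<in> lists {..<k}" "\<forall>f\<in>F. f @ t \<in> U" by blast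
  then obtain t' where "t' \<in> lists {..<k}" "(f @ t) @ t' \<in> U"
    using U insert.prems unfolding dense_open_def by (metis append_in_lists_conv insert_subset)
  moreover have "f' @ t @ t' \<in> U" if "f' \<in> F" for f'
    using t(2) that U unfolding dense_open_def by (metis append_assoc)
  ultimately show ?case using t(1) by (intro bexI[of _ "t @ t'"]) auto
qed auto

text \<open>Between its new letters, \<open>g\<close> carries words of constants that force a prefix
  into \<open>U n\<close> whatever \<open>w\<close> substitutes for the variables so far. So every
  \<open>w \<circ> g\<close> is generic and lies in one cylinder, where \<open>c\<close> is constant
  on generic words.\<close>

lemma borel_coloring_rsurj:
  fixes c :: "(nat \<Rightarrow> nat) \<Rightarrow> nat"
  assumes c: "c \<in> borel \<rightarrow>\<^sub>M count_space UNIV" and K: "\<And>z. c z < K"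
  shows "\<exists>g. rsurj g \<and> (\<forall>i<k. g i = i) \<and>
    (\<exists>col. \<forall>w. (\<forall>i<k. w i = i) \<longrightarrow> range w \<subseteq> {..<k} \<longrightarrow> c (w \<circ> g) = col)"
proof -
  have s: "[0..<k] \<in> lists {..<k}" by auto
  obtain U t where U: "\<forall>n. dense_open k (U n)" and t: "t \<in> lists {..<k}"
    and const': "\<forall>z\<in>cylinder k ([0..<k] @ t) \<inter> generic U. \<forall>z'\<in>cylinder k ([0..<k] @ t) \<inter> generic U. c z = c z'"
    using borel_coloring_locally_constant[OF c K s] by blast
  have const: "\<And>z z'. z \<in> cylinder k ([0..<k] @ t) \<Longrightarrow> z \<in> generic U \<Longrightarrow>
      z' \<in> cylinder k ([0..<k] @ t) \<Longrightarrow> z' \<in> generic U \<Longrightarrow> c z = c z'"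
    using const' by blast
  \<comment> \<open>The length \<open>Suc (length l)\<close> accounts for \<open>l\<close> followed
    by the new letter, whose values under \<open>w\<close> are all anticipated.\<close>
  define Y where "Y n l = (SOME y. y \<in> lists {..<k} \<and>
      (\<forall>f\<in>{xs. set xs \<subseteq> {..<k} \<and> length xs = Suc (length l)}. f @ y \<in> U n))" for n and l :: "nat list"
  have Y': "Y n l \<in> lists {..<k} \<and>
      (\<forall>f\<in>{xs. set xs \<subseteq> {..<k} \<and> length xs = Suc (length l)}. f @ Y n l \<in> U n)" for n l
    unfolding Y_def
  proof (rule someI_ex)
    have "\<exists>y\<in>lists {..<k}. \<forall>f\<in>{xs. set xs \<subseteq> {..<k} \<and> length xs = Suc (length l)}. f @ y \<in> U n"
      by (rule dense_open_uniform_extension[OF spec[OF U] finite_lists_length_eq]) auto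
    then show "\<exists>y. y \<in> lists {..<k} \<and>
      (\<forall>f\<in>{xs. set xs \<subseteq> {..<k} \<and> length xs = Suc (length l)}. f @ y \<in> U n)" by blast
  qed
  then have Y: "Y n l \<in> lists {..<k}"
    "f \<in> lists {..<k} \<Longrightarrow> length f = Suc (length l) \<Longrightarrow> f @ Y n l \<in> U n" for n l f
    by (simp_all add: lists_eq_set)
  define l where "l = rec_nat ([0..<k] @ t) (\<lambda>n r. r @ (k + n) # Y n r)"
  have l: "l 0 = [0..<k] @ t" "\<And>n. l (Suc n) = l n @ (k + n) # Y n (l n)" by (simp_all add: l_def)
  have "\<exists>g. rsurj g \<and> (\<forall>i<k. g i = i) \<and> (\<forall>n. map g [0..<length (l n)] = l n) \<and>
    (\<forall>n. g (length (l n)) = k + n) \<and> (\<forall>n. \<forall>i<length (l n). g i < k + n)"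
  proof (rule rsurj_from_prefixes)
    have "Y n r \<in> lists {..k + n}" for n r
      using Y(1)[of n r] by (auto simp: less_imp_le trans_less_add1)
    then show "\<exists>y\<in>lists {..k + n}. l (Suc n) = l n @ (k + n) # y" for n
      using l(2) by blast
  qed (use l t in auto)
  then obtain g where g: "rsurj g" "\<forall>i<k. g i = i" "\<And>n. map g [0..<length (l n)] = l n" by blast
  have mapw: "map w x = x" if "\<forall>i<k. w i = i" "x \<in> lists {..<k}" for w :: "nat \<Rightarrow> nat" and x
    using that by (auto intro!: map_idI)
  have mem: "w \<circ> g \<in> cylinder k ([0..<k] @ t) \<inter> generic U"
    if w: "\<forall>i<k. w i = i" "range w \<subseteq> {..<k}" for w
  proof
    have "map (w \<circ> g) [0..<length (l 0)] = map w (l 0)" using g(3)[of 0] by (metis map_map)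
    also have "\<dots> = l 0" using l t by (intro mapw[OF w(1)]) auto
    finally show "w \<circ> g \<in> cylinder k ([0..<k] @ t)" using w(2) unfolding cylinder_def l(1) by auto
    have "map (w \<circ> g) [0..<length (l (Suc n))] \<in> U n" for n
    proof -
      have "map (w \<circ> g) [0..<length (l (Suc n))] = map w (l (Suc n))" using g(3) by (metis map_map)
      also have "\<dots> = map w (l n @ [k + n]) @ Y n (l n)" unfolding l(2) using mapw[OF w(1) Y(1)] by simp
      also have "\<dots> \<in> U n" using w(2) by (intro Y(2)) (auto simp: subset_iff)
      finally show ?thesis .
    qed
    then show "w \<circ> g \<in> generic U" unfolding generic_def by blast
  qed
  have "\<exists>col. \<forall>w. (\<forall>i<k. w i = i) \<longrightarrow> range w \<subseteq> {..<k} \<longrightarrow> c (w \<circ> g) = col"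
  proof (cases "\<exists>w. (\<forall>i<k. w i = i) \<and> range w \<subseteq> {..<k}")
    case True
    then obtain w0 where w0: "\<forall>i<k. w0 i = i" "range w0 \<subseteq> {..<k}" by blast
    have "c (w \<circ> g) = c (w0 \<circ> g)" if "\<forall>i<k. w i = i" "range w \<subseteq> {..<k}" for w
      using mem[OF that] mem[OF w0] by (intro const) auto
    then show ?thesis by blast
  qed blast
  then show ?thesis using g(1,2) by blast
qed

section \<open>The dual Ramsey theorem\<close>

definition words :: "nat \<Rightarrow> (nat \<Rightarrow> nat) set" where
  "words m = {w. range w = {..<m} \<and> rigid w}"

text \<open>The conditions on \<open>w\<close> make \<open>p\<close> the first position of the
  letter \<open>j\<close>. For \<open>j = 0\<close> this is position 0, and then \<open>c\<close> is
  constant on \<open>words m\<close>, which is the goal of the descent.\<close>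

definition determined :: "nat \<Rightarrow> nat \<Rightarrow> ((nat \<Rightarrow> nat) \<Rightarrow> nat) \<Rightarrow> bool" where
  "determined m j c \<longleftrightarrow> (\<forall>w\<in>words m. \<forall>w'\<in>words m. \<forall>p.
     w p = j \<longrightarrow> (\<forall>i<p. w i < j) \<longrightarrow> (\<forall>i\<le>p. w' i = w i) \<longrightarrow> c w = c w')"

lemma words_comp:
  assumes "w \<in> words m" "rsurj h"
  shows "w \<circ> h \<in> words m"
proof -
  have "range (w \<circ> h) = w ` range h" by (simp add: image_comp)
  then show ?thesis using assms rigid_comp[of w h] unfolding words_def rsurj_def by simp
qed

lemma words_less: "w \<in> words m \<Longrightarrow> w i < m"
  unfolding words_def by auto

text \<open>The letter \<open>j\<close> first occurs in \<open>w \<circ> h\<close> where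
  \<open>h\<close> first takes the value \<open>p\<close>, and up to there \<open>h\<close> stays
  within \<open>{..p}\<close>.\<close>

lemma determined_comp:
  assumes c: "determined m j c" and h: "rsurj h"
  shows "determined m j (\<lambda>w. c (w \<circ> h))"
  unfolding determined_def
proof (intro ballI allI impI)
  fix w w' p assume w: "w \<in> words m" "w' \<in> words m" "w p = j" "\<forall>i<p. w i < j" "\<forall>i\<le>p. w' i = w i"
  obtain N where N: "h N = p" "\<forall>i<N. h i < p" using rsurj_first_occurrence[OF h] by blast
  have "h i \<le> p" if "i \<le> N" for i using N that by (metis le_less order_refl)
  then show "c (w \<circ> h) = c (w' \<circ> h)"
    using c[unfolded determined_def, rule_format, OF words_comp[OF w(1) h] words_comp[OF w(2) h], of N]
      w N by simp
qed

section \<open>Fusion of rigid surjections\<close>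

lemma fusion_stage:
  fixes Q :: "((nat \<Rightarrow> nat) \<Rightarrow> nat) \<Rightarrow> bool"
  assumes Q: "\<And>c h. Q c \<Longrightarrow> rsurj h \<Longrightarrow> Q (\<lambda>w. c (w \<circ> h))"
    and step: "\<And>c u p. Q c \<Longrightarrow> u \<in> words m \<Longrightarrow> u p = j \<Longrightarrow> \<forall>i<p. u i < j \<Longrightarrow>
      \<exists>h. rsurj h \<and> (\<forall>i\<le>p. h i = i) \<and> (\<exists>col. \<forall>w\<in>words m. (\<forall>i\<le>p. w i = u i) \<longrightarrow> c (w \<circ> h) = col)"
    and c: "Q c"
  shows "\<exists>h. rsurj h \<and> (\<forall>i\<le>p. h i = i) \<and> (\<forall>w\<in>words m. \<forall>w'\<in>words m.
     w p = j \<longrightarrow> (\<forall>i<p. w i < j) \<longrightarrow> (\<forall>i\<le>p. w' i = w i) \<longrightarrow> c (w \<circ> h) = c (w' \<circ> h))"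
proof -
  \<comment> \<open>Only finitely many prefixes end at position \<open>p\<close>; in the induction,
    \<open>S\<close> holds those already treated.\<close>
  have fin: "finite ({..p} \<rightarrow>\<^sub>E {..<m})" by (simp add: finite_PiE)
  have "\<exists>h. rsurj h \<and> (\<forall>i\<le>p. h i = i) \<and> (\<forall>w\<in>words m. \<forall>w'\<in>words m.
     w p = j \<longrightarrow> (\<forall>i<p. w i < j) \<longrightarrow> (\<forall>i\<le>p. w' i = w i) \<longrightarrow> restrict w {..p} \<in> S \<longrightarrow> c (w \<circ> h) = c (w' \<circ> h))"
    if "finite S" for S
    using that
  proof (induction S rule: finite_induct)
    case empty
    show ?case by (intro exI[of _ id] conjI rsurj_id) simp_all
  next
    case (insert v S)
    from insert.IH obtain h where h0: "rsurj h \<and> (\<forall>i\<le>p. h i = i) \<and> (\<forall>w\<in>words m. \<forall>w'\<in>words m.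
      w p = j \<longrightarrow> (\<forall>i<p. w i < j) \<longrightarrow> (\<forall>i\<le>p. w' i = w i) \<longrightarrow> restrict w {..p} \<in> S \<longrightarrow>
      c (w \<circ> h) = c (w' \<circ> h))" ..
    then have h: "rsurj h" "\<forall>i\<le>p. h i = i" by simp_all
    have hS: "c (w \<circ> h) = c (w' \<circ> h)"
      if "w \<in> words m" "w' \<in> words m" "w p = j" "\<forall>i<p. w i < j" "\<forall>i\<le>p. w' i = w i"
        "restrict w {..p} \<in> S" for w w'
    proof -
      from h0 have "\<forall>w\<in>words m. \<forall>w'\<in>words m.
        w p = j \<longrightarrow> (\<forall>i<p. w i < j) \<longrightarrow> (\<forall>i\<le>p. w' i = w i) \<longrightarrow> restrict w {..p} \<in> S \<longrightarrow>
        c (w \<circ> h) = c (w' \<circ> h)" by (elim conjE)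
      from bspec[OF bspec[OF this that(1)] that(2)] show ?thesis using that(3-6) by (elim impE)
    qed
    show ?case
    proof (cases "\<exists>u\<in>words m. u p = j \<and> (\<forall>i<p. u i < j) \<and> restrict u {..p} = v")
      case False
      then show ?thesis using h0 by (intro exI[of _ h]) blast
    next
      case True
      then obtain u where u: "u \<in> words m" "u p = j" "\<forall>i<p. u i < j" "restrict u {..p} = v" by blast
      have "\<exists>h'. rsurj h' \<and> (\<forall>i\<le>p. h' i = i) \<and>
          (\<exists>col. \<forall>w\<in>words m. (\<forall>i\<le>p. w i = u i) \<longrightarrow> c (w \<circ> h' \<circ> h) = col)"
        by (rule step[OF Q[OF c h(1)] u(1-3)])
      then obtain h' where h'0: "rsurj h' \<and> (\<forall>i\<le>p. h' i = i) \<and>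
          (\<exists>col. \<forall>w\<in>words m. (\<forall>i\<le>p. w i = u i) \<longrightarrow> c (w \<circ> h' \<circ> h) = col)" ..
      then have h': "rsurj h'" "\<forall>i\<le>p. h' i = i" by simp_all
      from h'0 have "\<exists>col. \<forall>w\<in>words m. (\<forall>i\<le>p. w i = u i) \<longrightarrow> c (w \<circ> h' \<circ> h) = col" by (elim conjE)
      then obtain col where
        col': "\<forall>w\<in>words m. (\<forall>i\<le>p. w i = u i) \<longrightarrow> c (w \<circ> h' \<circ> h) = col" ..
      have col: "c (w \<circ> h' \<circ> h) = col" if "w \<in> words m" "\<forall>i\<le>p. w i = u i" for w
        using bspec[OF col' that(1)] that(2) by (elim impE)
      have "c (w \<circ> (h' \<circ> h)) = c (w' \<circ> (h' \<circ> h))"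
        if w: "w \<in> words m" "w' \<in> words m" "w p = j" "\<forall>i<p. w i < j" "\<forall>i\<le>p. w' i = w i"
          "restrict w {..p} \<in> insert v S" for w w'
      proof (cases "restrict w {..p} = v")
        case True
        then have "\<forall>i\<le>p. w i = u i" using u(4) by (metis atMost_iff restrict_apply')
        then show ?thesis using col[OF w(1)] col[OF w(2)] w(5) by (simp add: comp_assoc)
      next
        case False
        \<comment> \<open>The new factor fixes all positions up to \<open>p\<close>, so
          \<open>w \<circ> h'\<close> has the prefix of \<open>w\<close> and the earlier stage still
          applies to it.\<close>
        have "restrict (w \<circ> h') {..p} = restrict w {..p}" using h'(2) by (intro restrict_ext) simp
        then have "restrict (w \<circ> h') {..p} \<in> S" using False w(6) by auto
        then show ?thesis
          using hS[OF words_comp[OF w(1) h'(1)] words_comp[OF w(2) h'(1)]] w h'(2)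
          by (simp add: comp_assoc)
      qed
      moreover have "rsurj (h' \<circ> h)" "\<forall>i\<le>p. (h' \<circ> h) i = i"
        using rsurj_comp h h' by auto
      ultimately show ?thesis by blast
    qed
  qed
  from this[OF fin] obtain h where h: "rsurj h \<and> (\<forall>i\<le>p. h i = i) \<and>
      (\<forall>w\<in>words m. \<forall>w'\<in>words m. w p = j \<longrightarrow> (\<forall>i<p. w i < j) \<longrightarrow> (\<forall>i\<le>p. w' i = w i) \<longrightarrow>
        restrict w {..p} \<in> {..p} \<rightarrow>\<^sub>E {..<m} \<longrightarrow> c (w \<circ> h) = c (w' \<circ> h))"
    ..
  then have h1: "rsurj h" "\<forall>i\<le>p. h i = i" by simp_all
  from h have hS: "\<forall>w\<in>words m. \<forall>w'\<in>words m.
      w p = j \<longrightarrow> (\<forall>i<p. w i < j) \<longrightarrow> (\<forall>i\<le>p. w' i = w i) \<longrightarrow>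
        restrict w {..p} \<in> {..p} \<rightarrow>\<^sub>E {..<m} \<longrightarrow> c (w \<circ> h) = c (w' \<circ> h)" by (elim conjE)
  have "c (w \<circ> h) = c (w' \<circ> h)"
    if w: "w \<in> words m" "w' \<in> words m" "w p = j" "\<forall>i<p. w i < j" "\<forall>i\<le>p. w' i = w i" for w w'
  proof -
    have "restrict w {..p} \<in> {..p} \<rightarrow>\<^sub>E {..<m}" using words_less[OF w(1)] by auto
    then show ?thesis using bspec[OF bspec[OF hS w(1)] w(2)] w(3-5) by (elim impE)
  qed
  then show ?thesis by (intro exI[of _ h] conjI h1 ballI impI)
qed

text \<open>Later factors of the fusion sequence \<open>H\<close> fix ever longer initial segments, so the diagonal
  \<open>\<lambda>i. H i i\<close> factors through every \<open>H n\<close>.\<close>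

lemma fusion_limit:
  fixes H :: "nat \<Rightarrow> nat \<Rightarrow> nat"
  assumes H: "\<And>n. rsurj (H n)"
    and step: "\<And>n. \<exists>g. rsurj g \<and> (\<forall>i\<le>Suc n. g i = i) \<and> H (Suc n) = g \<circ> H n"
  shows "rsurj (\<lambda>i. H i i)"
    and "\<exists>G. rsurj G \<and> (\<forall>i\<le>n. G i = i) \<and> (\<lambda>i. H i i) = G \<circ> H n"
proof -
  have fac: "\<exists>g. (\<forall>i\<le>n. g i = i) \<and> H N = g \<circ> H n" if "n \<le> N" for n N
    using that
  proof (induction N rule: dec_induct)
    case base
    show ?case by (intro exI[of _ id]) auto
  next
    case (step N)
    then obtain g g' where "\<forall>i\<le>n. g i = i" "H N = g \<circ> H n" "\<forall>i\<le>Suc N. g' i = i" "H (Suc N) = g' \<circ> H N"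
      using assms(2)[of N] by blast
    then show ?case using step(1) by (intro exI[of _ "g' \<circ> g"]) auto
  qed
  have le: "H n i \<le> i" for n i using H rigid_le unfolding rsurj_def by blast
  \<comment> \<open>Rigidity gives \<open>H i i \<le> i\<close>, and factors after stage
    \<open>i\<close> fix all numbers up to \<open>i\<close>.\<close>
  have diag: "H i i = H N i" if "i \<le> N" for i N
    using fac[OF that] le[of i i] by auto
  have "\<exists>i'<i. H i' i' = y" if "y < H i i" for i y
  proof -
    have "rigid (H i)" using H by (simp add: rsurj_def)
    from rigidD[OF this that] obtain i' where "i' < i" "H i i' = y" by blast
    then show ?thesis using diag[of i' i] by auto
  qed
  then have rig: "rigid (\<lambda>i. H i i)" unfolding rigid_def by blast
  have val: "\<exists>i. H n i = y" for n y using H[of n] unfolding rsurj_def surj_def by metis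
  have fixed: "H i i = H n i" if "H n i \<le> n" for i n
  proof (cases "i \<le> n")
    case False
    then show ?thesis using fac[of n i] that by auto
  qed (rule diag)
  have "\<exists>i. H i i = y" for y
  proof -
    obtain i where "H y i = y" using val by blast
    then show ?thesis using fixed[of y i] by auto
  qed
  then show rs: "rsurj (\<lambda>i. H i i)" using rig unfolding rsurj_def surj_def by metis
  \<comment> \<open>The factorisation forces the value \<open>H i i\<close> at \<open>H n i\<close>.
    The least such \<open>i\<close> is one choice, and \<open>GH\<close> shows that all choices
    agree.\<close>
  define G where "G y = (let i = (LEAST i. H n i = y) in H i i)" for y
  have first: "\<exists>i. H n i = y \<and> (\<forall>i'<i. H n i' < y) \<and> G y = H i i" for y
  proof -
    obtain i where i: "H n i = y" "\<forall>i'<i. H n i' < y" using rsurj_first_occurrence[OF H] by blast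
    have "(LEAST i. H n i = y) = i"
    proof (rule Least_equality)
      fix i' assume "H n i' = y"
      then show "i \<le> i'" using i(2) by (metis leI less_irrefl)
    qed (rule i(1))
    then show ?thesis using i unfolding G_def by auto
  qed
  have GH: "G (H n i) = H i i" for i
  proof -
    obtain i' where i': "H n i' = H n i" "G (H n i) = H i' i'" using first by blast
    let ?N = "max n (max i i')"
    obtain g where "H ?N = g \<circ> H n" using fac[of n ?N] by auto
    then have "H ?N i = H ?N i'" using i'(1) by simp
    then show ?thesis using i'(2) diag[of i ?N] diag[of i' ?N] by simp
  qed
  have "rigid G"
    unfolding rigid_def
  proof (intro allI impI)
    fix x y assume "y < G x"
    moreover obtain i where i: "H n i = x" "\<forall>i'<i. H n i' < x" "G x = H i i" using first by blast
    ultimately obtain i' where "i' < i" "H i' i' = y" using rigidD[OF rig, of y i] by auto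
    then show "\<exists>x'<x. G x' = y" using i(2) GH by blast
  qed
  moreover have "surj G" using rs GH unfolding rsurj_def surj_def by metis
  moreover have "G i = i" if "i \<le> n" for i
    using first[of i] fixed that by metis
  moreover have "(\<lambda>i. H i i) = G \<circ> H n" using GH by auto
  ultimately show "\<exists>G. rsurj G \<and> (\<forall>i\<le>n. G i = i) \<and> (\<lambda>i. H i i) = G \<circ> H n"
    unfolding rsurj_def by blast
qed

text \<open>Stage \<open>p\<close> handles all words in which \<open>j\<close> first occurs at
  position \<open>p\<close>, and the diagonal serves all \<open>p\<close> at once. \<open>Q\<close>
  stands for the class of colourings to which the one-prefix step applies: bounded Borel ones in the
  base case, bounded ones determined at the next letter later on.\<close>

lemma fusion:
  fixes Q :: "((nat \<Rightarrow> nat) \<Rightarrow> nat) \<Rightarrow> bool"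
  assumes Q: "\<And>c h. Q c \<Longrightarrow> rsurj h \<Longrightarrow> Q (\<lambda>w. c (w \<circ> h))"
    and step: "\<And>c u p. Q c \<Longrightarrow> u \<in> words m \<Longrightarrow> u p = j \<Longrightarrow> \<forall>i<p. u i < j \<Longrightarrow>
      \<exists>h. rsurj h \<and> (\<forall>i\<le>p. h i = i) \<and> (\<exists>col. \<forall>w\<in>words m. (\<forall>i\<le>p. w i = u i) \<longrightarrow> c (w \<circ> h) = col)"
    and c: "Q c"
  shows "\<exists>h. rsurj h \<and> determined m j (\<lambda>w. c (w \<circ> h))"
proof -
  define det where "det p h \<longleftrightarrow> (\<forall>w\<in>words m. \<forall>w'\<in>words m.
     w p = j \<longrightarrow> (\<forall>i<p. w i < j) \<longrightarrow> (\<forall>i\<le>p. w' i = w i) \<longrightarrow> c (w \<circ> h) = c (w' \<circ> h))" for p h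
  have stage: "\<exists>h'. (rsurj h' \<and> det p h') \<and> (\<exists>g. rsurj g \<and> (\<forall>i\<le>p. g i = i) \<and> h' = g \<circ> h)"
    if h: "rsurj h" for p h
  proof -
    have "\<exists>g. rsurj g \<and> (\<forall>i\<le>p. g i = i) \<and> (\<forall>w\<in>words m. \<forall>w'\<in>words m.
     w p = j \<longrightarrow> (\<forall>i<p. w i < j) \<longrightarrow> (\<forall>i\<le>p. w' i = w i) \<longrightarrow> c (w \<circ> g \<circ> h) = c (w' \<circ> g \<circ> h))"
    proof (rule fusion_stage[where Q = Q and c = "\<lambda>w. c (w \<circ> h)"])
      show "Q (\<lambda>w. c (w \<circ> h))" by (rule Q[OF c h])
    qed (erule (1) Q, erule (3) step)
    then obtain g where g: "rsurj g" "\<forall>i\<le>p. g i = i" "\<forall>w\<in>words m. \<forall>w'\<in>words m.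
     w p = j \<longrightarrow> (\<forall>i<p. w i < j) \<longrightarrow> (\<forall>i\<le>p. w' i = w i) \<longrightarrow> c (w \<circ> g \<circ> h) = c (w' \<circ> g \<circ> h)"
      by blast
    have "det p (g \<circ> h)" using g(3) unfolding det_def by (simp only: comp_assoc)
    then show ?thesis
      by (intro exI[of _ "g \<circ> h"] exI[of _ g] conjI rsurj_comp g(1,2) h refl)
  qed
  have "\<exists>H. \<forall>n. (rsurj (H n) \<and> det n (H n)) \<and> (\<exists>g. rsurj g \<and> (\<forall>i\<le>Suc n. g i = i) \<and> H (Suc n) = g \<circ> H n)"
  proof (rule dependent_nat_choice[where P = "\<lambda>n h. rsurj h \<and> det n h"])
    show "\<exists>h. rsurj h \<and> det 0 h" using stage[OF rsurj_id, of 0] by (elim exE conjE) (rule exI, rule conjI)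
  next
    fix h n assume "rsurj h \<and> det n h"
    then show "\<exists>h'. (rsurj h' \<and> det (Suc n) h') \<and> (\<exists>g. rsurj g \<and> (\<forall>i\<le>Suc n. g i = i) \<and> h' = g \<circ> h)"
      by (intro stage) simp
  qed
  then obtain H where H': "\<forall>n. (rsurj (H n) \<and> det n (H n)) \<and>
    (\<exists>g. rsurj g \<and> (\<forall>i\<le>Suc n. g i = i) \<and> H (Suc n) = g \<circ> H n)" ..
  then have H: "rsurj (H n)" "det n (H n)"
    "\<exists>g. rsurj g \<and> (\<forall>i\<le>Suc n. g i = i) \<and> H (Suc n) = g \<circ> H n" for n by simp_all
  have "determined m j (\<lambda>w. c (w \<circ> (\<lambda>i. H i i)))"
    unfolding determined_def
  proof (intro ballI allI impI)
    fix w w' p assume w: "w \<in> words m" "w' \<in> words m" "w p = j" "\<forall>i<p. w i < j" "\<forall>i\<le>p. w' i = w i"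
    \<comment> \<open>\<open>G\<close> fixes the positions up to \<open>p\<close>, so
      \<open>w \<circ> G\<close> and \<open>w' \<circ> G\<close> still agree there and stage
      \<open>p\<close> applies to them.\<close>
    obtain G where G: "rsurj G" "\<forall>i\<le>p. G i = i" "(\<lambda>i. H i i) = G \<circ> H p"
      using fusion_limit(2)[of H, OF H(1,3)] by blast
    have "c (w \<circ> G \<circ> H p) = c (w' \<circ> G \<circ> H p)"
      using H(2)[of p, unfolded det_def, rule_format, OF words_comp[OF w(1) G(1)] words_comp[OF w(2) G(1)]]
        w(3-5) G(2) by simp
    then show "c (w \<circ> (\<lambda>i. H i i)) = c (w' \<circ> (\<lambda>i. H i i))" unfolding G(3) by (simp add: comp_assoc)
  qed
  then show ?thesis using fusion_limit(1)[of H, OF H(1,3)] by blast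
qed

section \<open>Exchanging a given prefix for the prefix 0, ..., j\<close>

definition glue :: "(nat \<Rightarrow> nat) \<Rightarrow> nat \<Rightarrow> nat \<Rightarrow> (nat \<Rightarrow> nat) \<Rightarrow> nat \<Rightarrow> nat" where
  "glue u p k w = (\<lambda>i. if i \<le> p then u i else w (i - Suc p + k))"

lemma first_occurrence_letters:
  assumes "rigid u" "u p = j" "y < Suc j"
  shows "\<exists>i\<le>p. u i = y"
  using assms unfolding rigid_def by (metis less_Suc_eq less_imp_le order_refl)

lemma glue_words:
  assumes u: "u \<in> words m" "u p = j" "\<forall>i<p. u i < j"
    and w: "w \<in> words m" "\<forall>i<Suc j. w i = i"
  shows "glue u p (Suc j) w \<in> words m"
proof -
  have occ: "\<exists>i\<le>p. glue u p (Suc j) w i = y" if "y < Suc j" for y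
    using first_occurrence_letters[of u p j y] u that by (auto simp: words_def glue_def)
  have tail: "glue u p (Suc j) w (i - Suc j + Suc p) = w i" if "Suc j \<le> i" for i
    using that by (auto simp: glue_def dest!: le_Suc_ex)
  have big: "Suc j \<le> i" if "w i = y" "Suc j \<le> y" for i y
    using w(2) that by (metis leI le_antisym less_imp_le)
  have "rigid (glue u p (Suc j) w)"
    unfolding rigid_def
  proof (intro allI impI)
    fix i y assume y: "y < glue u p (Suc j) w i"
    show "\<exists>i'<i. glue u p (Suc j) w i' = y"
    proof (cases "i \<le> p")
      case True
      then have "y < u i" using y by (simp add: glue_def)
      then obtain i' where "i' < i" "u i' = y" using rigidD[of u y i] u(1) unfolding words_def by blast
      then show ?thesis using True by (intro exI[of _ i']) (auto simp: glue_def)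
    next
      case False
      show ?thesis
      proof (cases "y < Suc j")
        case True
        then show ?thesis using occ[of y] False by (metis leI le_less_trans)
      next
        case nb: False
        have "y < w (i - Suc p + Suc j)" using y False by (simp add: glue_def)
        then obtain i' where i': "i' < i - Suc p + Suc j" "w i' = y"
          using rigidD[of w y] w(1) unfolding words_def by blast
        then have "Suc j \<le> i'" using big nb by auto
        then show ?thesis using tail[of i'] i' False by (intro exI[of _ "i' - Suc j + Suc p"]) auto
      qed
    qed
  qed
  moreover have "range (glue u p (Suc j) w) = {..<m}"
  proof (intro equalityI subsetI)
    fix y assume "y \<in> {..<m}"
    show "y \<in> range (glue u p (Suc j) w)"
    proof (cases "y < Suc j")
      case True
      then show ?thesis using occ by blast
    next
      case False
      obtain i where i: "w i = y" using w(1) \<open>y \<in> {..<m}\<close> unfolding words_def by (metis (mono_tags, lifting) imageE mem_Collect_eq)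
      then have "Suc j \<le> i" using big False by auto
      then show ?thesis using tail[of i] i by (metis rangeI)
    qed
  qed (use words_less[OF u(1)] words_less[OF w(1)] in \<open>auto simp: glue_def\<close>)
  ultimately show ?thesis unfolding words_def by blast
qed

text \<open>Past its prefix, \<open>h\<close> copies the tail of \<open>g\<close>: letters above
  \<open>j\<close> are shifted to positions above \<open>p\<close>, and a letter
  \<open>y \<le> j\<close> becomes a position \<open>\<iota> y \<le> p\<close> at which
  \<open>u\<close> shows \<open>y\<close>. A word with prefix \<open>u\<close> then reads the tail
  as its counterpart with prefix 0, ..., j reads that of \<open>g\<close>.\<close>

lemma prefix_step:
  assumes u: "u \<in> words m" "u p = j" "\<forall>i<p. u i < j"
    and g: "rsurj g" "\<forall>i<Suc j. g i = i"
    and col: "\<And>w. w \<in> words m \<Longrightarrow> \<forall>i<Suc j. w i = i \<Longrightarrow> c (glue u p (Suc j) (w \<circ> g)) = col"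
  shows "\<exists>h. rsurj h \<and> (\<forall>i\<le>p. h i = i) \<and> (\<forall>w\<in>words m. (\<forall>i\<le>p. w i = u i) \<longrightarrow> c (w \<circ> h) = col)"
proof -
  obtain \<iota> where \<iota>: "\<And>y. y < Suc j \<Longrightarrow> \<iota> y \<le> p \<and> u (\<iota> y) = y"
    using first_occurrence_letters[of u p j] u unfolding words_def by (metis (mono_tags, lifting) mem_Collect_eq)
  define sh where "sh y = (if y < Suc j then \<iota> y else y - Suc j + Suc p)" for y
  define h where "h i = (if i \<le> p then i else sh (g (i - Suc p + Suc j)))" for i
  have low: "h i = i" if "i \<le> p" for i using that by (simp add: h_def)
  have tail: "h (i - Suc j + Suc p) = y - Suc j + Suc p" if "g i = y" "Suc j \<le> y" for i y
  proof -
    have "Suc j \<le> i" using that g(2) by (metis leI le_antisym less_imp_le)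
    then obtain d where "i = Suc j + d" using le_Suc_ex by blast
    then show ?thesis using that by (auto simp: h_def sh_def add.commute)
  qed
  have gge: "Suc j \<le> i" if "Suc j \<le> g i" for i
    using that g(2) by (metis leI le_antisym less_imp_le)
  have gex: "\<exists>i. g i = y" for y using g(1) unfolding rsurj_def surj_def by metis
  have "\<exists>i. h i = x" for x
  proof (cases "x \<le> p")
    case True
    then show ?thesis using low by blast
  next
    case False
    obtain i where "g i = x - Suc p + Suc j" using gex by blast
    then show ?thesis using tail[of i "x - Suc p + Suc j"] False by (intro exI[of _ "i - Suc j + Suc p"]) simp
  qed
  then have "surj h" unfolding surj_def by metis
  moreover have "rigid h"
    unfolding rigid_def
  proof (intro allI impI)
    fix i y assume y: "y < h i"
    show "\<exists>i'<i. h i' = y"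
    proof (cases "i \<le> p \<or> y \<le> p")
      case True
      then have "y \<le> p" "y < i" using y low[of i] by (cases "i \<le> p"; auto)+
      then show ?thesis using low by blast
    next
      case False
      let ?v = "g (i - Suc p + Suc j)"
      have hv: "h i = sh ?v" using False by (simp add: h_def)
      have v: "\<not> ?v < Suc j" using \<iota>[of ?v] y False hv by (auto simp: sh_def)
      then have "h i = ?v - Suc j + Suc p" unfolding hv sh_def by (rule if_not_P)
      then have "y - Suc p + Suc j < ?v" using v y False by linarith
      then obtain i' where i': "i' < i - Suc p + Suc j" "g i' = y - Suc p + Suc j"
        using rigidD[of g "y - Suc p + Suc j"] g(1) unfolding rsurj_def by blast
      then have "h (i' - Suc j + Suc p) = y" using tail[of i'] False by simp
      moreover have "i' - Suc j + Suc p < i" using i' gge[of i'] False by simp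
      ultimately show ?thesis by blast
    qed
  qed
  moreover have "c (w \<circ> h) = col" if w: "w \<in> words m" "\<forall>i\<le>p. w i = u i" for w
  proof -
    \<comment> \<open>The reverse of glueing: the part of \<open>w\<close> up to \<open>p\<close> is
      exchanged for 0, ..., j.\<close>
    define w' where "w' i = (if i < Suc j then i else w (i - Suc j + Suc p))" for i
    have jm: "Suc j \<le> m" using u(1,2) words_less by (metis Suc_leI)
    have wle: "Suc p \<le> i" if "w i = y" "Suc j \<le> y" for i y
      using w(2) u that by (metis Suc_leI leI le_less not_less_eq_eq)
    have w'x: "w' (i - Suc p + Suc j) = w i" if "Suc p \<le> i" for i
      using that by (auto simp: w'_def dest!: le_Suc_ex)
    have "w' \<in> words m"
    proof -
      have "rigid w'"
        unfolding rigid_def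
      proof (intro allI impI)
        fix i y assume y: "y < w' i"
        show "\<exists>i'<i. w' i' = y"
        proof (cases "i < Suc j \<or> y < Suc j")
          case True
          then have "y < Suc j" "y < i" using y by (auto simp: w'_def not_less split: if_splits)
          then show ?thesis by (intro exI[of _ y]) (simp add: w'_def)
        next
          case False
          then have "y < w (i - Suc j + Suc p)" using y by (simp add: w'_def)
          then obtain i' where i': "i' < i - Suc j + Suc p" "w i' = y"
            using rigidD[of w y] w(1) unfolding words_def by blast
          then have "Suc p \<le> i'" using wle False by auto
          then show ?thesis
            using i' w'x[of i'] False by (intro exI[of _ "i' - Suc p + Suc j"]) auto
        qed
      qed
      moreover have "range w' = {..<m}"
      proof (intro equalityI subsetI)
        fix y assume y: "y \<in> {..<m}"
        show "y \<in> range w'"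
        proof (cases "y < Suc j")
          case True
          then have "w' y = y" by (simp add: w'_def)
          then show ?thesis by (metis rangeI)
        next
          case False
          have "y \<in> range w" using w(1) y unfolding words_def by blast
          then obtain i where "w i = y" by blast
          then have "w' (i - Suc p + Suc j) = y" using w'x wle False by auto
          then show ?thesis by (metis rangeI)
        qed
      qed (use words_less[OF w(1)] jm in \<open>auto simp: w'_def\<close>)
      ultimately show ?thesis unfolding words_def by blast
    qed
    moreover have "\<forall>i<Suc j. w' i = i" by (simp add: w'_def)
    moreover have "w \<circ> h = glue u p (Suc j) (w' \<circ> g)"
    proof
      fix i
      have "w (sh y) = w' y" for y
        using \<iota>[of y] w(2) by (simp add: sh_def w'_def)
      then show "(w \<circ> h) i = glue u p (Suc j) (w' \<circ> g) i"
        using w(2) by (simp add: h_def glue_def)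
    qed
    ultimately show ?thesis using col by simp
  qed
  ultimately show ?thesis using low unfolding rsurj_def by blast
qed

section \<open>Descent to ever shorter deciding prefixes\<close>

lemma measurable_coordinatewise:
  fixes f :: "(nat \<Rightarrow> nat) \<Rightarrow> nat \<Rightarrow> nat"
  assumes "\<And>i. continuous_on UNIV (\<lambda>w. f w i)"
  shows "f \<in> borel \<rightarrow>\<^sub>M borel"
  by (intro borel_measurable_continuous_onI continuous_on_coordinatewise_then_product assms)

text \<open>After the last letter \<open>j\<close> has occurred, a word continues freely with
  letters up to \<open>j\<close>. All letters thus count as constants, and
  \<open>borel_coloring_rsurj\<close> applies with \<open>k = Suc j\<close>. The Borel hypothesis
  does its work here.\<close>

lemma dual_ramsey_base:
  fixes c :: "(nat \<Rightarrow> nat) \<Rightarrow> nat"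
  assumes "c \<in> borel \<rightarrow>\<^sub>M count_space UNIV" "\<And>w. c w < K"
  shows "\<exists>h. rsurj h \<and> determined (Suc j) j (\<lambda>w. c (w \<circ> h))"
proof (rule fusion[where Q = "\<lambda>c. c \<in> borel \<rightarrow>\<^sub>M count_space UNIV \<and> (\<forall>w. c w < K)"])
  fix c :: "(nat \<Rightarrow> nat) \<Rightarrow> nat" and h :: "nat \<Rightarrow> nat"
  assume c: "c \<in> borel \<rightarrow>\<^sub>M count_space UNIV \<and> (\<forall>w. c w < K)"
  have "(\<lambda>w :: nat \<Rightarrow> nat. w \<circ> h) \<in> borel \<rightarrow>\<^sub>M borel" by (rule measurable_coordinatewise) simp
  then show "(\<lambda>w. c (w \<circ> h)) \<in> borel \<rightarrow>\<^sub>M count_space UNIV \<and> (\<forall>w. c (w \<circ> h) < K)"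
    using c measurable_compose by blast
next
  fix c :: "(nat \<Rightarrow> nat) \<Rightarrow> nat" and u p
  assume c: "c \<in> borel \<rightarrow>\<^sub>M count_space UNIV \<and> (\<forall>w. c w < K)"
    and u: "u \<in> words (Suc j)" "u p = j" "\<forall>i<p. u i < j"
  have "continuous_on UNIV (\<lambda>w. glue u p (Suc j) w i)" for i
    by (cases "i \<le> p") (simp_all add: glue_def)
  then have "glue u p (Suc j) \<in> borel \<rightarrow>\<^sub>M borel" by (rule measurable_coordinatewise)
  then have "(\<lambda>w. c (glue u p (Suc j) w)) \<in> borel \<rightarrow>\<^sub>M count_space UNIV"
    using c measurable_compose by blast
  then obtain g col where g: "rsurj g" "\<forall>i<Suc j. g i = i"
    and col: "\<And>w. \<forall>i<Suc j. w i = i \<Longrightarrow> range w \<subseteq> {..<Suc j} \<Longrightarrow> c (glue u p (Suc j) (w \<circ> g)) = col"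
    using borel_coloring_rsurj[of "\<lambda>w. c (glue u p (Suc j) w)" K "Suc j"] c by blast
  have "c (glue u p (Suc j) (w \<circ> g)) = col" if "w \<in> words (Suc j)" "\<forall>i<Suc j. w i = i" for w
    using that by (intro col) (simp_all add: words_def)
  then show "\<exists>h. rsurj h \<and> (\<forall>i\<le>p. h i = i) \<and>
      (\<exists>col. \<forall>w\<in>words (Suc j). (\<forall>i\<le>p. w i = u i) \<longrightarrow> c (w \<circ> h) = col)"
    using prefix_step[OF u g, of c col] by blast
qed (use assms in auto)

text \<open>With the prefix up to the first \<open>j\<close> fixed, the colour depends only on the
  finite word between it and the first \<open>Suc j\<close>. It is thus a colouring of finite words
  over \<open>Suc j\<close> constants, as the Carlson-Simpson lemma requires.\<close>

lemma dual_ramsey_step: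
  fixes c :: "(nat \<Rightarrow> nat) \<Rightarrow> nat"
  assumes "determined m (Suc j) c" "\<And>w. c w < K" and j: "Suc j < m"
  shows "\<exists>h. rsurj h \<and> determined m j (\<lambda>w. c (w \<circ> h))"
proof (rule fusion[where Q = "\<lambda>c. determined m (Suc j) c \<and> (\<forall>w. c w < K)"])
  fix c :: "(nat \<Rightarrow> nat) \<Rightarrow> nat" and h :: "nat \<Rightarrow> nat"
  assume "determined m (Suc j) c \<and> (\<forall>w. c w < K)" "rsurj h"
  then show "determined m (Suc j) (\<lambda>w. c (w \<circ> h)) \<and> (\<forall>w. c (w \<circ> h) < K)"
    using determined_comp by blast
next
  fix c :: "(nat \<Rightarrow> nat) \<Rightarrow> nat" and u p
  assume c: "determined m (Suc j) c \<and> (\<forall>w. c w < K)"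
    and u: "u \<in> words m" "u p = j" "\<forall>i<p. u i < j"
  define k where "k = Suc j"
  define ext where "ext z w \<longleftrightarrow> w \<in> words m \<and> (\<forall>i<k. w i = i) \<and> map w [k..<k + length z] = z \<and>
      w (k + length z) = k" for z w
  \<comment> \<open>The choice of completion is immaterial, since \<open>c\<close> ignores
    everything beyond the first \<open>k\<close>. A \<open>z\<close> without completion gets some
    colour, still below \<open>K\<close>.\<close>
  define D where "D z = c (glue u p k (SOME w. ext z w))" for z
  obtain g col where g: "rsurj g" "\<forall>i<k. g i = i" and col: "\<And>w N. \<forall>i<k. w i = i \<Longrightarrow> k \<le> N \<Longrightarrow>
      \<forall>i<N. w (g i) < k \<Longrightarrow> k \<le> w (g N) \<Longrightarrow> D (map (w \<circ> g) [k..<N]) = col"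
    using carlson_simpson[of D K k] c unfolding D_def k_def by blast
  have "c (glue u p k (w \<circ> g)) = col" if w: "w \<in> words m" "\<forall>i<k. w i = i" for w
  proof -
    define v where "v = w \<circ> g"
    have v: "v \<in> words m" "\<forall>i<k. v i = i" using words_comp[OF w(1) g(1)] w(2) g(2) by (auto simp: v_def)
    have "k \<in> range v" using v(1) j unfolding words_def k_def by blast
    then have "\<exists>N. v N = k" by blast
    then obtain N where N: "v N = k" "\<forall>i<N. v i \<noteq> k" using exists_least_iff[of "\<lambda>N. v N = k"] by blast
    then have lt: "v i < k" if "i < N" for i
      using rigid_before_first[of v N i] v(1) that unfolding words_def by simp
    have kN: "k \<le> N" using v(2) N(1) by (metis leI nat_neq_iff)
    define z where "z = map v [k..<N]"
    have lz: "k + length z = N" using kN by (simp add: z_def)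
    have "ext z v" unfolding ext_def lz using v N(1) by (simp add: z_def)
    define v' where "v' = (SOME w. ext z w)"
    have e: "ext z v'" unfolding v'_def using \<open>ext z v\<close> by (rule someI[of "ext z" v])
    have v': "v' \<in> words m" "\<forall>i<k. v' i = i" "map v' [k..<N] = map v [k..<N]" "v' N = k"
      using e unfolding ext_def lz by (simp_all add: z_def)
    have eq: "v' i = v i" if iN: "i \<le> N" for i
    proof -
      consider "i < k" | "i = N" | "k \<le> i" "i < N" using iN by linarith
      then show ?thesis using v(2) v'(2-4) N(1) by cases auto
    qed
    \<comment> \<open>Where glueing moves position \<open>N\<close> of \<open>v\<close>: the first
      \<open>k\<close> in the glued word.\<close>
    let ?q = "N - k + Suc p"
    have "glue u p k v i < k" if "i < ?q" for i
    proof (cases "i \<le> p")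
      case True
      then show ?thesis using u(2,3) by (cases "i = p") (auto simp: glue_def k_def less_SucI)
    next
      case False
      then have "i - Suc p + k < N" using that kN by linarith
      then show ?thesis using lt False by (simp add: glue_def)
    qed
    moreover have "glue u p k v ?q = k" using N(1) kN by (auto simp: glue_def dest!: le_Suc_ex)
    moreover have "glue u p k v' i = glue u p k v i" if "i \<le> ?q" for i
    proof (cases "i \<le> p")
      case False
      then have "i - Suc p + k \<le> N" using that kN by linarith
      then show ?thesis using eq by (simp add: glue_def)
    qed (simp add: glue_def)
    moreover have "glue u p k v \<in> words m" "glue u p k v' \<in> words m"
      using glue_words[OF u v(1)] glue_words[OF u v'(1)] v(2) v'(2) unfolding k_def by blast+
    ultimately have "c (glue u p k v) = c (glue u p k v')"
      using c[unfolded determined_def] unfolding k_def by blast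
    also have "\<dots> = D z" by (simp add: D_def v'_def)
    also have "\<dots> = col"
      unfolding z_def v_def using w(2) kN lt N(1) by (intro col) (auto simp: v_def)
    finally show ?thesis unfolding v_def .
  qed
  then show "\<exists>h. rsurj h \<and> (\<forall>i\<le>p. h i = i) \<and>
      (\<exists>col. \<forall>w\<in>words m. (\<forall>i\<le>p. w i = u i) \<longrightarrow> c (w \<circ> h) = col)"
    using prefix_step[OF u g[unfolded k_def], of c col] unfolding k_def by blast
qed (use assms in auto)

theorem dual_ramsey:
  fixes c :: "(nat \<Rightarrow> nat) \<Rightarrow> nat"
  assumes c: "c \<in> borel \<rightarrow>\<^sub>M count_space UNIV" and K: "\<And>w. c w < K"
  shows "\<exists>h. rsurj h \<and> (\<exists>col. \<forall>w\<in>words m. c (w \<circ> h) = col)"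
proof (cases m)
  case 0
  then show ?thesis using rsurj_id by (auto simp: words_def)
next
  case (Suc n)
  \<comment> \<open>\<open>d\<close> counts steps down from the last letter \<open>n\<close>; by
    truncated subtraction, steps beyond the letter 0 change nothing.\<close>
  have "\<exists>h. rsurj h \<and> determined m (n - d) (\<lambda>w. c (w \<circ> h))" for d
  proof (induction d)
    case 0
    show ?case using dual_ramsey_base[OF c K, of n] by (simp only: \<open>m = Suc n\<close> diff_zero)
  next
    case (Suc d)
    then obtain h where h: "rsurj h" "determined m (n - d) (\<lambda>w. c (w \<circ> h))" by blast
    show ?case
    proof (cases "n - d = 0")
      case True
      then have "n - Suc d = n - d" by simp
      then show ?thesis using h by (intro exI[of _ h]) (simp only: simp_thms)
    next
      case False
      then have e: "n - d = Suc (n - Suc d)" by simp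
      have "\<exists>h'. rsurj h' \<and> determined m (n - Suc d) (\<lambda>w. c (w \<circ> h' \<circ> h))"
        using False \<open>m = Suc n\<close> by (intro dual_ramsey_step[OF h(2)[unfolded e] K]) simp
      then obtain h' where h': "rsurj h'" "determined m (n - Suc d) (\<lambda>w. c (w \<circ> h' \<circ> h))"
        by blast
      show ?thesis
        by (intro exI[of _ "h' \<circ> h"] conjI rsurj_comp h h'(1)) (use h'(2) in \<open>simp only: comp_assoc\<close>)
    qed
  qed
  from this[of n] obtain h where h: "rsurj h" "determined m 0 (\<lambda>w. c (w \<circ> h))" by auto
  have z: "w 0 = 0" if "w \<in> words m" for w using rigid_le[of w 0] that by (simp add: words_def)
  have "c (w \<circ> h) = c (w' \<circ> h)" if "w \<in> words m" "w' \<in> words m" for w w'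
    using h(2)[unfolded determined_def, rule_format, OF that, of 0] z[OF that(1)] z[OF that(2)] by simp
  then show ?thesis using h(1) by metis
qed

section \<open>Colourings of maps into the Cantor space\<close>

text \<open>Treated one by one: a later factor turns words into words, so a colouring made constant
  earlier stays constant.\<close>

lemma dual_ramsey_finite:
  fixes c :: "'i \<Rightarrow> (nat \<Rightarrow> nat) \<Rightarrow> nat" and m :: "'i \<Rightarrow> nat"
  assumes "finite I" "\<And>i. i \<in> I \<Longrightarrow> c i \<in> borel \<rightarrow>\<^sub>M count_space UNIV" "\<And>i w. i \<in> I \<Longrightarrow> c i w < K"
  shows "\<exists>h. rsurj h \<and> (\<forall>i\<in>I. \<exists>col. \<forall>w\<in>words (m i). c i (w \<circ> h) = col)"
  using assms
proof (induction I rule: finite_induct)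
  case empty
  show ?case using rsurj_id by blast
next
  case (insert i I)
  then obtain h where h: "rsurj h" "\<forall>i\<in>I. \<exists>col. \<forall>w\<in>words (m i). c i (w \<circ> h) = col" by blast
  have "(\<lambda>w :: nat \<Rightarrow> nat. w \<circ> h) \<in> borel \<rightarrow>\<^sub>M borel" by (rule measurable_coordinatewise) simp
  moreover have "c i \<in> borel \<rightarrow>\<^sub>M count_space UNIV" by (rule insert.prems(1)) simp
  ultimately have meas: "(\<lambda>w. c i (w \<circ> h)) \<in> borel \<rightarrow>\<^sub>M count_space UNIV" by (rule measurable_compose)
  have "\<exists>h'. rsurj h' \<and> (\<exists>col. \<forall>w\<in>words (m i). c i (w \<circ> h' \<circ> h) = col)"
    by (rule dual_ramsey[OF meas]) (rule insert.prems(2), simp)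
  then obtain h' where h': "rsurj h'" "\<exists>col. \<forall>w\<in>words (m i). c i (w \<circ> h' \<circ> h) = col" by blast
  have "\<exists>col. \<forall>w\<in>words (m i'). c i' (w \<circ> (h' \<circ> h)) = col" if "i' \<in> insert i I" for i'
  proof (cases "i' = i")
    case True
    then show ?thesis using h'(2) by (simp only: comp_assoc)
  next
    case False
    then have "i' \<in> I" using that by simp
    from bspec[OF h(2) this] obtain col where col: "\<forall>w\<in>words (m i'). c i' (w \<circ> h) = col" ..
    have "c i' (w \<circ> (h' \<circ> h)) = col" if "w \<in> words (m i')" for w
      using bspec[OF col words_comp[OF that h'(1)]] by (simp only: comp_assoc)
    then show ?thesis by (intro exI[of _ col] ballI)
  qed
  then show ?case by (intro exI[of _ "h' \<circ> h"] conjI ballI rsurj_comp[OF h'(1) h(1)])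
qed

text \<open>\<open>w\<close> numbers the values of \<open>F\<close> in order of first appearance.
  Rigidity holds because the increasing enumeration \<open>e\<close> of \<open>P\<close> sends each
  letter to its first position.\<close>

lemma word_decomposition:
  fixes F :: "nat \<Rightarrow> 'b"
  assumes "finite (range F)"
  shows "\<exists>w s. w \<in> words (card (range F)) \<and> (\<forall>i. F i = s (w i))"
proof -
  define P where "P = {i. \<forall>i'<i. F i' \<noteq> F i}"
  define first where "first i = (LEAST i'. F i' = F i)" for i
  have first: "F (first i) = F i" "first i \<le> i" "first i \<in> P" for i
  proof -
    show eq: "F (first i) = F i" unfolding first_def by (rule LeastI) (rule refl)
    show "first i \<le> i" unfolding first_def by (rule Least_le) (rule refl)
    have "F i' \<noteq> F i" if "i' < first i" for i'
      using that unfolding first_def by (rule not_less_Least)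
    then show "first i \<in> P" unfolding P_def using eq by simp
  qed
  have inj: "inj_on F P"
  proof (rule linorder_inj_onI)
    show "F x \<noteq> F y" if "x < y" "x \<in> P" "y \<in> P" for x y using that unfolding P_def by simp
  qed (rule nat_le_linear)
  have fix_P: "first i = i" if "i \<in> P" for i
    by (rule inj_onD[OF inj first(1) first(3) that])
  have im: "F ` P = range F"
  proof (intro equalityI subsetI)
    fix y assume "y \<in> range F"
    then obtain i where "y = F i" by blast
    then show "y \<in> F ` P" using first(1,3)[of i] by (intro image_eqI[of _ _ "first i"]) simp_all
  qed blast
  then have fin: "finite P" using assms inj by (metis finite_imageD)
  have card: "card P = card (range F)" using card_image[OF inj] im by simp
  obtain e where e: "bij_betw e {..<card P} P" "strict_mono_on {..<card P} e"
    using ex_bij_betw_strict_mono_card[OF fin] .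
  define w where "w i = inv_into {..<card P} e (first i)" for i
  have img: "e ` {..<card P} = P" and einj: "inj_on e {..<card P}" using e(1) by (auto simp: bij_betw_def)
  have ew: "e (w i) = first i" "w i < card P" for i
    using f_inv_into_f[of "first i" e "{..<card P}"] inv_into_into[of "first i" e "{..<card P}"] img first(3)[of i]
    unfolding w_def by auto
  have we: "w (e j) = j" if "j < card P" for j
  proof -
    have "e j \<in> P" using img that by auto
    then have "first (e j) = e j" by (rule fix_P)
    then show ?thesis using inv_into_f_f[OF einj, of j] that unfolding w_def by simp
  qed
  have "rigid w"
    unfolding rigid_def
  proof (intro allI impI)
    fix i y assume y: "y < w i"
    then have yP: "y < card P" using ew(2)[of i] by simp
    have "e y < e (w i)" using strict_mono_onD[OF e(2) _ _ y] yP ew(2)[of i] by simp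
    then have "e y < i" using ew(1)[of i] first(2)[of i] by simp
    then show "\<exists>i'<i. w i' = y" using we[OF yP] by blast
  qed
  moreover have "range w = {..<card P}"
  proof (intro equalityI subsetI)
    fix j assume "j \<in> {..<card P}"
    then have "j = w (e j)" using we by simp
    then show "j \<in> range w" by (rule range_eqI)
  qed (use ew(2) in auto)
  ultimately have "w \<in> words (card (range F))" unfolding words_def card by blast
  moreover have "\<forall>i. F i = F (e (w i))" using ew(1) first(1) by simp
  ultimately show ?thesis by (intro exI[of _ w] exI[of _ "\<lambda>j. F (e j)"]) blast
qed

section \<open>Transfer from words to maps into the Cantor space\<close>

lemma continuous_map_Pfun: "continuous_map cantor_space cantor_space (Pfun h)"
proof -
  have "continuous_map cantor_space (discrete_topology UNIV) (\<lambda>x. x (h n))" for n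
    unfolding cantor_space_def by (rule continuous_map_product_projection) simp
  then show ?thesis
    by (simp add: cantor_space_def continuous_map_componentwise_UNIV Pfun_def)
qed

text \<open>Since \<open>h \<circ> inv h\<close> is the identity, \<open>Pfun (inv h)\<close> is a
  continuous left inverse of \<open>Pfun h\<close>.\<close>

lemma is_cantor_set_range_Pfun:
  assumes "surj h"
  shows "is_cantor_set (range (Pfun h))"
proof -
  have inv: "h (inv h y) = y" for y using assms by (rule surj_f_inv_f)
  have "homeomorphic_maps cantor_space (subtopology cantor_space (range (Pfun h))) (Pfun h) (Pfun (inv h))"
    unfolding homeomorphic_maps_def
  proof (intro conjI ballI)
    show "continuous_map cantor_space (subtopology cantor_space (range (Pfun h))) (Pfun h)"
      by (rule continuous_map_into_subtopology[OF continuous_map_Pfun]) auto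
    show "continuous_map (subtopology cantor_space (range (Pfun h))) cantor_space (Pfun (inv h))"
      by (rule continuous_map_from_subtopology[OF continuous_map_Pfun])
  qed (auto simp: Pfun_def fun_eq_iff inv)
  then show ?thesis
    unfolding is_cantor_set_def using homeomorphic_space_sym homeomorphic_space_def by blast
qed

text \<open>The 0-1 matrix with rows in \<open>A\<close> whose column \<open>n\<close> is
  \<open>s (w n)\<close>.\<close>

definition decode :: "'a set \<Rightarrow> (nat \<Rightarrow> 'a \<Rightarrow> bool) \<Rightarrow> (nat \<Rightarrow> nat) \<Rightarrow> 'a \<Rightarrow> nat \<Rightarrow> bool" where
  "decode A s w = (\<lambda>a\<in>A. \<lambda>n. s (w n) a)"

lemma decode_in_Map: "decode A s w \<in> Map A UNIV"
  by (simp add: decode_def Map_def)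

lemma continuous_map_decode: "continuous_map euclidean (Map_space A) (decode A s)"
proof -
  have "continuous_map euclidean (discrete_topology UNIV) (\<lambda>w :: nat \<Rightarrow> nat. s (w n) a)" for a n
  proof -
    have "continuous_map euclidean euclidean (\<lambda>w :: nat \<Rightarrow> nat. w n)"
      by (simp add: continuous_on_product_coordinates)
    moreover have "continuous_map (euclidean :: nat topology) (discrete_topology UNIV) (\<lambda>x. s x a)"
      by (simp add: continuous_map_def open_discrete)
    ultimately show ?thesis using continuous_map_compose[of euclidean euclidean "\<lambda>w. w n" _ "\<lambda>x. s x a"]
      by (simp add: comp_def)
  qed
  then have "continuous_map euclidean cantor_space (\<lambda>w :: nat \<Rightarrow> nat. \<lambda>n. s (w n) a)" for a
    by (simp add: cantor_space_def continuous_map_componentwise_UNIV)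
  then show ?thesis
    unfolding Map_space_def decode_def by (auto simp: continuous_map_componentwise)
qed

text \<open>The colouring is Borel for an abstract topology, the Ramsey theorem speaks of the
  measure \<open>borel\<close>; the measure generated by the open sets of \<open>Map_space A\<close>
  links the two.\<close>

lemma measurable_coloring_decode:
  assumes "borel_coloring (Map_space A) k \<gamma>"
  shows "(\<lambda>w. \<gamma> (decode A s w)) \<in> borel \<rightarrow>\<^sub>M count_space UNIV"
proof -
  let ?X = "Map_space A"
  have sub: "{U. openin ?X U} \<subseteq> Pow (topspace ?X)" using openin_subset by blast
  have "decode A s \<in> borel \<rightarrow>\<^sub>M sigma (topspace ?X) {U. openin ?X U}"
  proof (rule measurable_measure_of[OF sub])
    show "decode A s \<in> space borel \<rightarrow> topspace ?X" by (simp add: topspace_Map_space decode_in_Map)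
    fix U assume "U \<in> {U. openin ?X U}"
    then have "open (decode A s -` U)"
      using openin_continuous_map_preimage[OF continuous_map_decode, of A U s] by (simp add: vimage_def)
    then show "decode A s -` U \<inter> space borel \<in> sets borel" by simp
  qed
  moreover have "\<gamma> \<in> sigma (topspace ?X) {U. openin ?X U} \<rightarrow>\<^sub>M count_space {..<k}"
  proof (subst measurable_count_space_eq2, simp, intro conjI ballI)
    show "\<gamma> \<in> space (sigma (topspace ?X) {U. openin ?X U}) \<rightarrow> {..<k}"
      using assms by (simp add: borel_coloring_def space_measure_of[OF sub])
    fix i assume "i \<in> {..<k}"
    then have "{x \<in> topspace ?X. \<gamma> x = i} \<in> sigma_sets (topspace ?X) {U. openin ?X U}"
      using assms by (simp add: borel_coloring_def borel_sets_of_def)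
    moreover have "\<gamma> -` {i} \<inter> topspace ?X = {x \<in> topspace ?X. \<gamma> x = i}" by auto
    ultimately show "\<gamma> -` {i} \<inter> space (sigma (topspace ?X) {U. openin ?X U}) \<in>
        sets (sigma (topspace ?X) {U. openin ?X U})"
      using sub by (simp add: space_measure_of[OF sub] sets_measure_of[OF sub])
  qed
  ultimately have "(\<lambda>w. \<gamma> (decode A s w)) \<in> borel \<rightarrow>\<^sub>M count_space {..<k}" by (rule measurable_compose)
  then show ?thesis by (rule measurable_compose) simp
qed

text \<open>Column \<open>n\<close> of the composite is column \<open>h n\<close> of
  \<open>f\<close>. So \<open>s\<close> and \<open>w\<close> come from \<open>f\<close> alone and
  serve every \<open>h\<close>, which merely turns \<open>w\<close> into
  \<open>w \<circ> h\<close>.\<close>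

lemma compose_Pfun_decode:
  assumes A: "finite A" and f: "f \<in> Map A UNIV"
  shows "\<exists>m\<le>card (A \<rightarrow>\<^sub>E (UNIV :: bool set)). \<exists>s\<in>{..<m} \<rightarrow>\<^sub>E (A \<rightarrow>\<^sub>E UNIV). \<exists>w\<in>words m.
    \<forall>h. compose A (Pfun h) f = decode A s (w \<circ> h)"
proof -
  let ?B = "A \<rightarrow>\<^sub>E (UNIV :: bool set)"
  define F where "F n = (\<lambda>a\<in>A. f a n)" for n
  have finB: "finite ?B" using A by (simp add: finite_PiE)
  have FB: "range F \<subseteq> ?B" by (auto simp: F_def)
  define m where "m = card (range F)"
  have "finite (range F)" using FB finB finite_subset by blast
  then obtain w s where w: "w \<in> words m" and s: "\<And>i. F i = s (w i)"
    using word_decomposition[of F] unfolding m_def by blast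
  have "m \<le> card ?B" unfolding m_def by (rule card_mono[OF finB FB])
  moreover have "restrict s {..<m} \<in> {..<m} \<rightarrow>\<^sub>E ?B"
  proof (rule restrict_PiE_iff[THEN iffD2], rule ballI)
    fix j assume "j \<in> {..<m}"
    then have "j \<in> range w" using w unfolding words_def by blast
    then show "s j \<in> ?B" using s FB by (metis rangeE rangeI subsetD)
  qed
  moreover have "compose A (Pfun h) f = decode A (restrict s {..<m}) (w \<circ> h)" for h
  proof -
    have "restrict s {..<m} (w n) = F n" for n using words_less[OF w] s by simp
    then show ?thesis by (auto simp: compose_def Pfun_def decode_def F_def fun_eq_iff)
  qed
  ultimately show ?thesis using w by blast
qed

text \<open>Lets the Cantor set \<open>range (Pfun h)\<close> inherit the bound; values are lifted
  row by row through \<open>inv (Pfun h)\<close>.\<close>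

lemma Map_range_Pfun: "Map A (range (Pfun h)) = {compose A (Pfun h) f |f. f \<in> Map A UNIV}"
proof (intro equalityI subsetI)
  fix g assume g: "g \<in> Map A (range (Pfun h))"
  let ?f = "\<lambda>a\<in>A. inv (Pfun h) (g a)"
  have "g a = compose A (Pfun h) ?f a" for a
  proof (cases "a \<in> A")
    case True
    then have "g a \<in> range (Pfun h)" using g unfolding Map_def by blast
    then show ?thesis using True by (simp add: compose_def f_inv_into_f)
  next
    case False
    then show ?thesis using g by (auto simp: Map_def compose_def PiE_def extensional_def)
  qed
  then have "g = compose A (Pfun h) ?f" ..
  moreover have "?f \<in> Map A UNIV" by (simp add: Map_def)
  ultimately show "g \<in> {compose A (Pfun h) f |f. f \<in> Map A UNIV}" by blast
qed (auto simp: Map_def compose_def)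

theorem theorem3p3:
  fixes A :: "'a set"
  assumes "finite A" and "A \<noteq> {}"
  shows "\<exists>t::nat. 1 \<le> t \<and>
    (\<forall>(k::nat) (\<gamma> :: ('a \<Rightarrow> nat \<Rightarrow> bool) \<Rightarrow> nat).
       1 \<le> k \<longrightarrow> borel_coloring (Map_space A) k \<gamma> \<longrightarrow>
         (\<exists>h\<in>RSurj. card (\<gamma> ` {compose A (Pfun h) f |f. f \<in> Map A UNIV}) \<le> t) \<and>
         (\<exists>K. is_cantor_set K \<and> card (\<gamma> ` Map A K) \<le> t))"
proof -
  let ?B = "A \<rightarrow>\<^sub>E (UNIV :: bool set)"
  \<comment> \<open>One colour will remain for each pair \<open>(m, s)\<close>, so
    \<open>t = card I\<close>. A map with row set \<open>A\<close> has at most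
    \<open>card ?B\<close> distinct columns, which bounds \<open>m\<close>.\<close>
  define I where "I = (SIGMA m:{..card ?B}. {..<m} \<rightarrow>\<^sub>E ?B)"
  have finI: "finite I"
    unfolding I_def using assms(1) by (intro finite_SigmaI finite_PiE) (auto simp: finite_PiE)
  have "(0, \<lambda>_. undefined) \<in> I" unfolding I_def by auto
  then have t: "1 \<le> card I" using finI by (metis One_nat_def Suc_leI card_gt_0_iff empty_iff)
  have main: "\<exists>h\<in>RSurj. card (\<gamma> ` {compose A (Pfun h) f |f. f \<in> Map A UNIV}) \<le> card I \<and>
      is_cantor_set (range (Pfun h))"
    if \<gamma>: "borel_coloring (Map_space A) k \<gamma>" for k and \<gamma> :: "('a \<Rightarrow> nat \<Rightarrow> bool) \<Rightarrow> nat"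
  proof -
    have bound: "\<gamma> (decode A s w) < k" for s w
      using \<gamma> decode_in_Map[of A s w] unfolding borel_coloring_def topspace_Map_space by auto
    have "\<exists>h. rsurj h \<and> (\<forall>i\<in>I. \<exists>col. \<forall>w\<in>words (fst i). \<gamma> (decode A (snd i) (w \<circ> h)) = col)"
      by (rule dual_ramsey_finite[OF finI measurable_coloring_decode[OF \<gamma>] bound])
    then obtain h where h: "rsurj h"
      and "\<forall>i\<in>I. \<exists>col. \<forall>w\<in>words (fst i). \<gamma> (decode A (snd i) (w \<circ> h)) = col" by blast
    from bchoice[OF this(2)] obtain col where
      col: "\<forall>i\<in>I. \<forall>w\<in>words (fst i). \<gamma> (decode A (snd i) (w \<circ> h)) = col i" ..
    have "\<gamma> ` {compose A (Pfun h) f |f. f \<in> Map A UNIV} \<subseteq> col ` I"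
    proof
      fix y assume "y \<in> \<gamma> ` {compose A (Pfun h) f |f. f \<in> Map A UNIV}"
      then obtain f where f: "f \<in> Map A UNIV" "y = \<gamma> (compose A (Pfun h) f)" by blast
      obtain m s w where m: "m \<le> card ?B" "s \<in> {..<m} \<rightarrow>\<^sub>E ?B" "w \<in> words m"
        and eq: "compose A (Pfun h) f = decode A s (w \<circ> h)"
        using compose_Pfun_decode[OF assms(1) f(1)] by blast
      have mI: "(m, s) \<in> I" using m unfolding I_def by simp
      have "y = col (m, s)" using bspec[OF col mI] m(3) f(2) eq by simp
      then show "y \<in> col ` I" using mI by (rule image_eqI)
    qed
    then have "card (\<gamma> ` {compose A (Pfun h) f |f. f \<in> Map A UNIV}) \<le> card I"
      using surj_card_le finI by blast
    moreover have "is_cantor_set (range (Pfun h))"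
      using h by (intro is_cantor_set_range_Pfun) (simp add: rsurj_def)
    ultimately show ?thesis using rsurj_imp_RSurj[OF h] by blast
  qed
  show ?thesis
  proof (rule exI[of _ "card I"], intro conjI allI impI t)
    fix k and \<gamma> :: "('a \<Rightarrow> nat \<Rightarrow> bool) \<Rightarrow> nat"
    assume "borel_coloring (Map_space A) k \<gamma>"
    from main[OF this] obtain h where h: "h \<in> RSurj" "is_cantor_set (range (Pfun h))"
      "card (\<gamma> ` {compose A (Pfun h) f |f. f \<in> Map A UNIV}) \<le> card I" by blast
    show "\<exists>h\<in>RSurj. card (\<gamma> ` {compose A (Pfun h) f |f. f \<in> Map A UNIV}) \<le> card I"
      by (rule bexI[of _ h]) (rule h(3), rule h(1))
    show "\<exists>K. is_cantor_set K \<and> card (\<gamma> ` Map A K) \<le> card I"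
      by (intro exI[of _ "range (Pfun h)"] conjI h(2)) (simp only: Map_range_Pfun h(3))
  qed
qed

end
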